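(* The bijections $\psi:\mathrm{revSSYT}\to\mathrm{qKT}^{(1)}$ and $\Gamma:\mathrm{revSSYT}\to\mathcal{A}\mathrm{SSF}$ restrict to bijections $\mathrm{QrevSSYT}\to\mathrm{QqKT}^{(1)}$ and $\mathrm{QrevSSYT}\to\mathrm{QSSF}$ respectively.
   Context: $\mathrm{revSSYT}$: reverse semistandard Young tableaux of all partition shapes (English notation; positive integer entries; rows weakly decrease left to right, columns strictly decrease top to bottom). For a weak composition $a$, $D(a)$ has $a_i$ left-justified boxes in row $i$, row 1 lowest. Quasi-key tableau of shape $a$: filling of $D(a)$ with positive integers such that (1) rows weakly decrease and no entry of row $i$ exceeds $i$; (2) column entries distinct, increasing going up the first column; (3) if $i$ is above $k$ in a column with $i<k$, there is an entry $j>i$ immediately right of $k$; (4) for two rows with the higher strictly longer, an entry $i$ in column $c$ of the lower and $j$ in column $c+1$ of the higher satisfy $i<j$. $\mathrm{qKT}^{(1)}$: all quasi-key tableaux (all shapes) with first-column entries equal to row indices. Triples of $D(a)$ (rows $r<s$): Type A: $\gamma=(r,c),\alpha=(r,c+1),\beta=(s,c+1)$, $a_r\ge a_s$; Type B: $\gamma=(s,c),\alpha=(s,c+1),\beta=(r,c)$, $a_s>a_r$; inversion triple: $\beta>\gamma\ge\alpha$ or $\gamma\ge\alpha>\beta$. $\mathcal{A}\mathrm{SSF}$: all fillings of skyline diagrams $D(a)$ (all $a$) with positive integers, rows weakly decreasing, distinct column entries, all triples inversion triples, first-column entry of each nonempty row $i$ equal to $i$. $\psi$ (right row-filling): with column sets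 $C_1,C_2,\ldots$ of $V$, repeatedly let $k$ be the largest index with $C_k\neq\emptyset$, choose the smallest $y_k\in C_k$, then for $c=k-1,\ldots,1$ the smallest $y_c\in C_c$ with $y_c\ge y_{c+1}$; make $(y_1,\ldots,y_k)$ row $y_1$ of the output and delete these elements; it is known to be a bijection onto $\mathrm{qKT}^{(1)}$. $\Gamma$ (column-filling): column 1 of $\Gamma(V)$ places each entry $i$ of column 1 of $V$ in row $i$; given column $c$, the entries of column $c+1$ of $V$ are placed in decreasing order, each in the lowest row that has an entry in column $c$ weakly larger than it and an unfilled position in column $c+1$; it is known to be a bijection $\mathrm{revSSYT}\to\mathcal{A}\mathrm{SSF}$. A filling $X$ (in any of these three sets) is quasi-Yamanouchi if for every entry value $i$ of $X$, the leftmost occurrence of $i$ is in the first column of $X$ or lies in a column weakly left of some occurrence of $i+1$. $\mathrm{QrevSSYT}$, $\mathrm{QqKT}^{(1)}$, $\mathrm{QSSF}$ denote the quasi-Yamanouchi elements of $\mathrm{revSSYT}$, $\mathrm{qKT}^{(1)}$, $\mathcal{A}\mathrm{SSF}$. *)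

theory Defs
  imports Main
begin

text \<open>Conventions. All fillings are represented as lists of rows, a row being a list of
  entries; index 0 of a row is column 1.
  For reverse SSYT (English notation) list index 0 is the TOP row.
  For skyline fillings of D(a), list index r is row r+1 (row 1 lowest); the weak
  composition a is (length of row 1, length of row 2, ...) with trailing zero parts
  dropped, i.e. the list is normalised so that its last row (if any) is nonempty.\<close>

type_synonym filling = "nat list list"

definition cells :: "filling \<Rightarrow> (nat \<times> nat) set" where
  "cells T = {(r, c). r < length T \<and> c < length (T ! r)}"

definition vals :: "filling \<Rightarrow> nat set" where
  "vals T = (\<lambda>(r, c). T ! r ! c) ` cells T"

definition occ :: "filling \<Rightarrow> nat \<Rightarrow> (nat \<times> nat) set" where
  "occ T i = {(r, c) \<in> cells T. T ! r ! c = i}"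

definition positive_entries :: "filling \<Rightarrow> bool" where
  "positive_entries T \<longleftrightarrow> (\<forall>(r, c) \<in> cells T. 0 < T ! r ! c)"

definition rows_weakly_decr :: "filling \<Rightarrow> bool" where
  "rows_weakly_decr T \<longleftrightarrow>
     (\<forall>r c. r < length T \<longrightarrow> Suc c < length (T ! r) \<longrightarrow> T ! r ! Suc c \<le> T ! r ! c)"

definition columns_distinct :: "filling \<Rightarrow> bool" where
  "columns_distinct T \<longleftrightarrow>
     (\<forall>r s c. r < length T \<longrightarrow> s < length T \<longrightarrow> r \<noteq> s \<longrightarrow>
        c < length (T ! r) \<longrightarrow> c < length (T ! s) \<longrightarrow> T ! r ! c \<noteq> T ! s ! c)"

definition quasi_yamanouchi :: "filling \<Rightarrow> bool" where
  "quasi_yamanouchi T \<longleftrightarrow>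
     (\<forall>i \<in> vals T. let c0 = Min (snd ` occ T i) in
        c0 = 0 \<or> (\<exists>(r, c) \<in> occ T (Suc i). c0 \<le> c))"

definition revSSYT :: "filling set" where
  "revSSYT = {T. (\<forall>r < length T. T ! r \<noteq> [])
       \<and> (\<forall>r. Suc r < length T \<longrightarrow> length (T ! Suc r) \<le> length (T ! r))
       \<and> positive_entries T
       \<and> rows_weakly_decr T
       \<and> (\<forall>r c. Suc r < length T \<longrightarrow> c < length (T ! Suc r) \<longrightarrow> T ! Suc r ! c < T ! r ! c)}"

definition normalized_sky :: "filling \<Rightarrow> bool" where
  "normalized_sky T \<longleftrightarrow> (T = [] \<or> last T \<noteq> [])"

definition first_col_rows :: "filling \<Rightarrow> bool" where
  "first_col_rows T \<longleftrightarrow> (\<forall>r < length T. T ! r \<noteq> [] \<longrightarrow> T ! r ! 0 = Suc r)"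

definition quasi_key :: "filling \<Rightarrow> bool" where
  "quasi_key T \<longleftrightarrow>
     positive_entries T
     \<comment> \<open>(1)\<close>
     \<and> rows_weakly_decr T
     \<and> (\<forall>r c. r < length T \<longrightarrow> c < length (T ! r) \<longrightarrow> T ! r ! c \<le> Suc r)
     \<comment> \<open>(2)\<close>
     \<and> columns_distinct T
     \<and> (\<forall>r s. r < s \<longrightarrow> s < length T \<longrightarrow> T ! r \<noteq> [] \<longrightarrow> T ! s \<noteq> [] \<longrightarrow>
            T ! r ! 0 < T ! s ! 0)
     \<comment> \<open>(3): entry i in row s above entry k in row r, same column c, i < k\<close>
     \<and> (\<forall>r s c. r < s \<longrightarrow> s < length T \<longrightarrow> c < length (T ! r) \<longrightarrow> c < length (T ! s) \<longrightarrow>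
            T ! s ! c < T ! r ! c \<longrightarrow>
            (Suc c < length (T ! r) \<and> T ! s ! c < T ! r ! Suc c))
     \<comment> \<open>(4)\<close>
     \<and> (\<forall>r s c. r < s \<longrightarrow> s < length T \<longrightarrow> length (T ! r) < length (T ! s) \<longrightarrow>
            c < length (T ! r) \<longrightarrow> Suc c < length (T ! s) \<longrightarrow>
            T ! r ! c < T ! s ! Suc c)"

definition qKT1 :: "filling set" where
  "qKT1 = {T. normalized_sky T \<and> quasi_key T \<and> first_col_rows T}"

definition inversion_triple :: "nat \<Rightarrow> nat \<Rightarrow> nat \<Rightarrow> bool" where
  "inversion_triple \<beta> \<gamma> \<alpha> \<longleftrightarrow> (\<beta> > \<gamma> \<and> \<gamma> \<ge> \<alpha>) \<or> (\<gamma> \<ge> \<alpha> \<and> \<alpha> > \<beta>)"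

definition all_inversion_triples :: "filling \<Rightarrow> bool" where
  "all_inversion_triples T \<longleftrightarrow>
     (\<forall>r s c. r < s \<longrightarrow> s < length T \<longrightarrow> length (T ! s) \<le> length (T ! r) \<longrightarrow>
        Suc c < length (T ! s) \<longrightarrow>
        inversion_triple (T ! s ! Suc c) (T ! r ! c) (T ! r ! Suc c))
   \<and> (\<forall>r s c. r < s \<longrightarrow> s < length T \<longrightarrow> length (T ! r) < length (T ! s) \<longrightarrow>
        c < length (T ! r) \<longrightarrow>
        inversion_triple (T ! r ! c) (T ! s ! c) (T ! s ! Suc c))"

definition ASSF :: "filling set" where
  "ASSF = {T. normalized_sky T \<and> positive_entries T \<and> rows_weakly_decr T
              \<and> columns_distinct T \<and> all_inversion_triples T \<and> first_col_rows T}"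

definition QrevSSYT :: "filling set" where
  "QrevSSYT = {T \<in> revSSYT. quasi_yamanouchi T}"

definition QqKT1 :: "filling set" where
  "QqKT1 = {T \<in> qKT1. quasi_yamanouchi T}"

definition QSSF :: "filling set" where
  "QSSF = {T \<in> ASSF. quasi_yamanouchi T}"

definition width :: "filling \<Rightarrow> nat" where
  "width T = foldr max (map length T) 0"

definition max_entry :: "filling \<Rightarrow> nat" where
  "max_entry T = foldr max (concat T) 0"

definition column :: "filling \<Rightarrow> nat \<Rightarrow> nat list" where
  "column T c = [T ! r ! c. r \<leftarrow> [0..<length T], c < length (T ! r)]"

definition strip_empty :: "filling \<Rightarrow> filling" where
  "strip_empty T = rev (dropWhile (\<lambda>x. x = []) (rev T))"

definition sky_of :: "(nat \<Rightarrow> nat list) \<Rightarrow> nat \<Rightarrow> filling" where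
  "sky_of R N = strip_empty (map R [1..<Suc N])"

fun sel :: "nat set list \<Rightarrow> nat \<Rightarrow> nat \<Rightarrow> nat list" where
  "sel Cs 0 b = []"
| "sel Cs (Suc c) b = (let y = Min {y \<in> Cs ! c. b \<le> y} in sel Cs c y @ [y])"

fun psi_aux :: "nat \<Rightarrow> nat set list \<Rightarrow> (nat \<Rightarrow> nat list) \<Rightarrow> (nat \<Rightarrow> nat list)" where
  "psi_aux 0 Cs R = R"
| "psi_aux (Suc n) Cs R =
     (if \<forall>C \<in> set Cs. C = {} then R
      else (let k = Max {k \<in> {..<length Cs}. Cs ! k \<noteq> {}};
                ys = sel Cs (Suc k) 0;
                Cs' = map (\<lambda>c. if c \<le> k then Cs ! c - {ys ! c} else Cs ! c) [0..<length Cs]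
            in psi_aux n Cs' (R(hd ys := ys))))"

text \<open>The fuel (number of cells) suffices since every round deletes elements.\<close>
definition psi :: "filling \<Rightarrow> filling" where
  "psi V = sky_of
     (psi_aux (length (concat V)) (map (\<lambda>c. set (column V c)) [0..<width V]) (\<lambda>_. []))
     (max_entry V)"

definition place :: "nat \<Rightarrow> nat \<Rightarrow> nat \<Rightarrow> (nat \<Rightarrow> nat list) \<Rightarrow> (nat \<Rightarrow> nat list)" where
  "place N c x R =
     (let cand = {r \<in> {1..N}. length (R r) = c \<and> x \<le> R r ! (c - 1)} in
      if cand = {} then R else R(Min cand := R (Min cand) @ [x]))"

definition fill_column :: "nat \<Rightarrow> filling \<Rightarrow> nat \<Rightarrow> (nat \<Rightarrow> nat list) \<Rightarrow> (nat \<Rightarrow> nat list)" where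
  "fill_column N V c R = fold (place N c) (rev (sort (column V c))) R"

definition Gamma :: "filling \<Rightarrow> filling" where
  "Gamma V = (let N = max_entry V;
                  R0 = (\<lambda>i. if i \<in> set (column V 0) then [i] else [])
              in sky_of (fold (fill_column N V) [1..<width V] R0) N)"

end

theory Submission
  imports Defs
begin

text \<open>
  Being quasi-Yamanouchi depends only on the column sets, and \<open>\<psi>\<close> and \<open>\<Gamma>\<close> preserve them, so it
  suffices that each of the three kinds of fillings is classified by its column sets. The families
  that occur are in all three cases the same: for every \<open>x\<close>, column \<open>c + 1\<close> has at most as many
  entries \<open>\<ge> x\<close> as column \<open>c\<close>.

  For skyline fillings with first column given by the row indices, the triple condition is
  equivalent to greediness: if \<open>x\<close> lies in column \<open>c + 1\<close> and a lower row has an entry \<open>\<ge> x\<close> in column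
  \<open>c\<close>, then that row continues with an entry \<open>> x\<close>. This is exactly what placing the entries of each
  column in decreasing order in the lowest possible row produces. The same greedy construction
  started from a strictly decreasing first column yields the reverse semistandard tableau.

  In a quasi-key tableau the lowest among the longest rows is the row selected first by \<open>\<psi>\<close>, and
  removing or adding such a row preserves both the quasi-key conditions and the domination
  condition on the columns.
\<close>

section \<open>Fillings as functions from rows to lists\<close>

text \<open>From here on a filling is a total function from row indices to lists, an absent row
  being \<open>[]\<close>. Deleting or inserting a row is then a function update.\<close>

definition colset :: "(nat \<Rightarrow> nat list) \<Rightarrow> nat \<Rightarrow> nat set" where
  "colset F c = {F r ! c | r. c < length (F r)}"

definition decr_rows :: "(nat \<Rightarrow> nat list) \<Rightarrow> bool" where
  "decr_rows F \<longleftrightarrow> (\<forall>r c. Suc c < length (F r) \<longrightarrow> F r ! Suc c \<le> F r ! c)"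

definition distinct_cols :: "(nat \<Rightarrow> nat list) \<Rightarrow> bool" where
  "distinct_cols F \<longleftrightarrow>
     (\<forall>r s c. r \<noteq> s \<longrightarrow> c < length (F r) \<longrightarrow> c < length (F s) \<longrightarrow> F r ! c \<noteq> F s ! c)"

definition first_col_index :: "(nat \<Rightarrow> nat list) \<Rightarrow> bool" where
  "first_col_index F \<longleftrightarrow> (\<forall>r. F r \<noteq> [] \<longrightarrow> F r ! 0 = r)"

definition greedy :: "(nat \<Rightarrow> nat list) \<Rightarrow> bool" where
  "greedy F \<longleftrightarrow>
     (\<forall>r s c. r < s \<longrightarrow> Suc c < length (F s) \<longrightarrow> c < length (F r) \<longrightarrow> F s ! Suc c \<le> F r ! c \<longrightarrow>
        Suc c < length (F r) \<and> F s ! Suc c < F r ! Suc c)"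

text \<open>Conditions (3) and (4) of quasi-key tableaux. In (4) the cell \<open>Suc c\<close> of
  row \<open>s\<close> exists because row \<open>s\<close> is strictly longer than row
  \<open>r\<close>.\<close>

definition key_rows :: "(nat \<Rightarrow> nat list) \<Rightarrow> bool" where
  "key_rows F \<longleftrightarrow>
     (\<forall>r s c. r < s \<longrightarrow> c < length (F r) \<longrightarrow> c < length (F s) \<longrightarrow> F s ! c < F r ! c \<longrightarrow>
        Suc c < length (F r) \<and> F s ! c < F r ! Suc c)
   \<and> (\<forall>r s c. r < s \<longrightarrow> length (F r) < length (F s) \<longrightarrow> c < length (F r) \<longrightarrow>
        F r ! c < F s ! Suc c)"

text \<open>For finite sets this is the Hall-type condition for an injection of \<open>B\<close>
  into \<open>A\<close> that sends every element to a weakly larger one.\<close>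

definition dominates :: "nat set \<Rightarrow> nat set \<Rightarrow> bool" where
  "dominates A B \<longleftrightarrow> (\<forall>x. card {y \<in> B. x \<le> y} \<le> card {y \<in> A. x \<le> y})"

definition column_family :: "(nat \<Rightarrow> nat set) \<Rightarrow> bool" where
  "column_family C \<longleftrightarrow>
     (\<forall>c. finite (C c) \<and> 0 \<notin> C c \<and> dominates (C c) (C (Suc c))) \<and> (\<exists>K. \<forall>c\<ge>K. C c = {})"

lemma colset_memI: "c < length (F r) \<Longrightarrow> F r ! c \<in> colset F c"
  by (auto simp: colset_def)

lemma colset_memE:
  assumes "y \<in> colset F c"
  obtains r where "c < length (F r)" "F r ! c = y"
  using assms by (auto simp: colset_def)

lemma finite_colset:
  assumes "finite {r. F r \<noteq> []}"
  shows "finite (colset F c)"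
proof -
  have "colset F c \<subseteq> (\<lambda>r. F r ! c) ` {r. F r \<noteq> []}"
    by (auto simp: colset_def)
  then show ?thesis using assms finite_subset by blast
qed

text \<open>The left neighbour of an entry >= \<open>x\<close> in column \<open>Suc c\<close> is an
  entry >= \<open>x\<close> in column \<open>c\<close>, and different rows have different left
  neighbours because columns are distinct.\<close>

lemma dominates_colset:
  assumes fin: "finite {r. F r \<noteq> []}" and dec: "decr_rows F" and dist: "distinct_cols F"
  shows "dominates (colset F c) (colset F (Suc c))"
  unfolding dominates_def
proof
  fix x
  let ?B = "{r. Suc c < length (F r) \<and> x \<le> F r ! Suc c}"
  have finB: "finite ?B"
    by (rule finite_subset[OF _ fin]) auto
  have "{y \<in> colset F (Suc c). x \<le> y} = (\<lambda>r. F r ! Suc c) ` ?B"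
    by (auto simp: colset_def)
  then have "card {y \<in> colset F (Suc c). x \<le> y} \<le> card ?B"
    using card_image_le[OF finB] by simp
  also have "\<dots> \<le> card {y \<in> colset F c. x \<le> y}"
  proof (rule card_inj_on_le)
    show "inj_on (\<lambda>r. F r ! c) ?B"
    proof (rule inj_onI, rule ccontr)
      fix r s assume "r \<in> ?B" "s \<in> ?B" "F r ! c = F s ! c" "r \<noteq> s"
      then show False using dist unfolding distinct_cols_def by auto
    qed
    show "(\<lambda>r. F r ! c) ` ?B \<subseteq> {y \<in> colset F c. x \<le> y}"
    proof (rule image_subsetI)
      fix r assume "r \<in> ?B"
      then have "c < length (F r)" "x \<le> F r ! Suc c" "F r ! Suc c \<le> F r ! c"
        using dec unfolding decr_rows_def by auto
      then show "F r ! c \<in> {y \<in> colset F c. x \<le> y}" using colset_memI by auto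
    qed
    show "finite {y \<in> colset F c. x \<le> y}"
      using finite_colset[OF fin] by simp
  qed
  finally show "card {y \<in> colset F (Suc c). x \<le> y} \<le> card {y \<in> colset F c. x \<le> y}" .
qed

lemma column_family_colset:
  assumes fin: "finite {r. F r \<noteq> []}" and dec: "decr_rows F" and dist: "distinct_cols F"
    and pos: "\<And>c. 0 \<notin> colset F c"
  shows "column_family (colset F)"
proof -
  have "colset F c = {}" if "Max ((length \<circ> F) ` {r. F r \<noteq> []}) \<le> c" for c
  proof (rule ccontr)
    assume "colset F c \<noteq> {}"
    then obtain r where r: "c < length (F r)"
      by (auto simp: colset_def)
    then have "length (F r) \<le> Max ((length \<circ> F) ` {r. F r \<noteq> []})"
      using fin by (intro Max_ge) auto
    with r that show False by simp
  qed
  then show ?thesis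
    unfolding column_family_def
    using finite_colset[OF fin] dominates_colset[OF fin dec dist] pos by blast
qed

text \<open>Domination at threshold 0 compares whole cardinalities, so emptiness passes to the next
  column.\<close>

lemma column_family_empty_mono:
  assumes "column_family C" and "C c = {}" and "c \<le> d"
  shows "C d = {}"
  using \<open>c \<le> d\<close>
proof (induction rule: dec_induct)
  case base
  then show ?case using assms by simp
next
  case (step d)
  have "card {y \<in> C (Suc d). 0 \<le> y} \<le> card {y \<in> C d. 0 \<le> y}" "finite (C (Suc d))"
    using assms(1) unfolding column_family_def dominates_def by blast+
  then show ?case using step by simp
qed

section \<open>Greedy placement of columns\<close>

text \<open>One column of the greedy construction: \<open>A\<close> are the rows reaching the
  current column, \<open>g\<close> their entries there, \<open>D\<close> the next column,
  \<open>A'\<close> the rows that are extended and \<open>h\<close> the new entries. The induction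
  inserts the elements of \<open>D\<close> in decreasing order, each into the lowest free row that
  admits it; elements placed later do not spoil the condition for those already placed.\<close>

lemma greedy_column_exists:
  fixes g :: "nat \<Rightarrow> nat"
  assumes finA: "finite A" and inj: "inj_on g A" and finD: "finite D"
    and dom: "dominates (g ` A) D"
  shows "\<exists>A' h. A' \<subseteq> A \<and> inj_on h A' \<and> h ` A' = D \<and> (\<forall>r\<in>A'. h r \<le> g r) \<and>
    (\<forall>r\<in>A. \<forall>s\<in>A'. r < s \<longrightarrow> h s \<le> g r \<longrightarrow> r \<in> A' \<and> h s < h r)"
  using finD dom
proof (induction D rule: finite_linorder_min_induct)
  case empty
  show ?case by (rule exI[of _ "{}"]) auto
next
  case (insert x D)
  have "dominates (g ` A) D"
    unfolding dominates_def
  proof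
    fix z
    have "card {y \<in> D. z \<le> y} \<le> card {y \<in> insert x D. z \<le> y}"
      using insert.hyps(1) by (intro card_mono) auto
    then show "card {y \<in> D. z \<le> y} \<le> card {y \<in> g ` A. z \<le> y}"
      using insert.prems unfolding dominates_def by (meson le_trans)
  qed
  then obtain A' h where A': "A' \<subseteq> A" "inj_on h A'" "h ` A' = D" "\<forall>r\<in>A'. h r \<le> g r"
    and low: "\<forall>r\<in>A. \<forall>s\<in>A'. r < s \<longrightarrow> h s \<le> g r \<longrightarrow> r \<in> A' \<and> h s < h r"
    using insert.IH by blast
  have gt: "x < h r" if "r \<in> A'" for r
    using that A'(3) insert.hyps(2) by blast
  let ?Q = "{r \<in> A - A'. x \<le> g r}"
  \<comment> \<open>A free row exists by counting: domination at threshold \<open>x\<close> gives at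
    least \<open>Suc (card D)\<close> rows with entry >= \<open>x\<close>, while only
    \<open>card D\<close> rows are occupied.\<close>
  have "?Q \<noteq> {}"
  proof
    assume "?Q = {}"
    then have sub: "{r \<in> A. x \<le> g r} \<subseteq> A'" by auto
    have finA': "finite A'" using A'(1) finA finite_subset by blast
    have "{y \<in> insert x D. x \<le> y} = insert x D"
      using insert.hyps(2) by (auto simp: less_imp_le)
    moreover have "x \<notin> D" using insert.hyps(2) by auto
    ultimately have "Suc (card D) \<le> card {y \<in> g ` A. x \<le> y}"
      using insert.prems insert.hyps(1) unfolding dominates_def
      by (metis card_insert_disjoint)
    also have "{y \<in> g ` A. x \<le> y} = g ` {r \<in> A. x \<le> g r}" by auto
    also have "card \<dots> \<le> card {r \<in> A. x \<le> g r}"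
      using finA by (intro card_image_le) auto
    also have "\<dots> \<le> card A'" using sub finA' card_mono by blast
    also have "\<dots> = card D" using card_image[OF A'(2)] A'(3) by simp
    finally show False by simp
  qed
  define s where "s = (LEAST r. r \<in> ?Q)"
  have s: "s \<in> A" "s \<notin> A'" "x \<le> g s"
    using LeastI_ex[of "\<lambda>r. r \<in> ?Q"] \<open>?Q \<noteq> {}\<close> unfolding s_def by auto
  have below: "r \<in> A'" if "r \<in> A" "r < s" "x \<le> g r" for r
    using not_less_Least[of r "\<lambda>r. r \<in> ?Q"] that unfolding s_def by blast
  let ?h = "h(s := x)"
  have img: "?h ` insert s A' = insert x D"
    using A'(3) s(2) by force
  have inj': "inj_on ?h (insert s A')"
  proof -
    have "x \<notin> h ` A'" using gt by auto
    moreover have "inj_on ?h A' \<longleftrightarrow> inj_on h A'"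
      using s(2) by (intro inj_on_cong) auto
    moreover have "?h ` A' = h ` A'" using s(2) by (intro image_cong) auto
    ultimately show ?thesis using A'(2) s(2) by simp
  qed
  have low': "r \<in> insert s A' \<and> ?h t < ?h r"
    if "r \<in> A" "t \<in> insert s A'" "r < t" "?h t \<le> g r" for r t
  proof (cases "t = s")
    case True
    then have "r \<in> A'" using below that by auto
    then show ?thesis using True s(2) gt by auto
  next
    case False
    then have "t \<in> A'" "h t \<le> g r" using that by auto
    then have "r \<in> A'" "h t < h r" using low that by auto
    then show ?thesis using False s(2) by auto
  qed
  show ?case
  proof (intro exI conjI)
    show "insert s A' \<subseteq> A" using A'(1) s(1) by blast
    show "\<forall>r\<in>insert s A'. ?h r \<le> g r" using A'(4) s by auto
    show "\<forall>r\<in>A. \<forall>t\<in>insert s A'. r < t \<longrightarrow> ?h t \<le> g r \<longrightarrow> r \<in> insert s A' \<and> ?h t < ?h r"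
      using low' by blast
  qed (fact inj' img)+
qed

text \<open>Iterates \<open>greedy_column_exists\<close> over the columns. The first column is
  prescribed by an arbitrary injective \<open>g\<close>, so the construction serves skyline
  fillings, where \<open>g\<close> is the identity, as well as tableaux, where \<open>g\<close>
  enumerates the column in decreasing order.\<close>

lemma greedy_filling_exists:
  fixes g :: "nat \<Rightarrow> nat"
  assumes C: "column_family C" and finA: "finite A" and inj: "inj_on g A" and gA: "g ` A = C 0"
  obtains F where "\<forall>r. F r \<noteq> [] \<longleftrightarrow> r \<in> A" "\<forall>r\<in>A. F r ! 0 = g r" "decr_rows F"
    "distinct_cols F" "greedy F" "colset F = C"
proof -
  \<comment> \<open>The length bound makes the rows that reach column \<open>n\<close> exactly those
    of length \<open>Suc n\<close>, so the entries of the next column are appended at the ends of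
    such rows.\<close>
  have ex: "\<exists>F. (\<forall>r. F r \<noteq> [] \<longleftrightarrow> r \<in> A) \<and> (\<forall>r\<in>A. F r ! 0 = g r) \<and> decr_rows F \<and>
    distinct_cols F \<and> greedy F \<and> (\<forall>c\<le>n. colset F c = C c) \<and> (\<forall>r. length (F r) \<le> Suc n)" for n
  proof (induction n)
    case 0
    let ?F = "\<lambda>r. if r \<in> A then [g r] else []"
    have "colset ?F 0 = C 0"
      using gA by (auto simp: colset_def)
    moreover have "distinct_cols ?F"
      using inj by (auto simp: distinct_cols_def inj_on_def split: if_splits)
    ultimately show ?case
      by (intro exI[of _ ?F]) (auto simp: decr_rows_def greedy_def split: if_splits)
  next
    case (Suc n)
    then obtain F where F: "\<forall>r. F r \<noteq> [] \<longleftrightarrow> r \<in> A" "\<forall>r\<in>A. F r ! 0 = g r" "decr_rows F"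
      "distinct_cols F" "greedy F" "\<forall>c\<le>n. colset F c = C c" "\<forall>r. length (F r) \<le> Suc n"
      by blast
    let ?A = "{r. length (F r) = Suc n}"
    let ?g = "\<lambda>r. F r ! n"
    have lenA: "n < length (F r) \<longleftrightarrow> r \<in> ?A" for r
      using F(7) by (metis (mono_tags) Suc_leI le_antisym lessI mem_Collect_eq)
    have "?g ` ?A = colset F n"
      unfolding colset_def using lenA by blast
    then have "?g ` ?A = C n" using F(6) by simp
    moreover have "finite ?A"
    proof (rule finite_subset[OF _ finA], rule subsetI)
      fix r assume "r \<in> ?A"
      then have "F r \<noteq> []" by auto
      then show "r \<in> A" using F(1) by blast
    qed
    moreover have "inj_on ?g ?A"
      using F(4) unfolding inj_on_def distinct_cols_def by (metis (mono_tags) lessI mem_Collect_eq)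
    moreover have "finite (C (Suc n))" "dominates (C n) (C (Suc n))"
      using C unfolding column_family_def by auto
    ultimately obtain A' h where A': "A' \<subseteq> ?A" "inj_on h A'" "h ` A' = C (Suc n)"
      "\<forall>r\<in>A'. h r \<le> F r ! n"
      and low: "\<And>r s. r\<in>?A \<Longrightarrow> s\<in>A' \<Longrightarrow> r < s \<Longrightarrow> h s \<le> F r ! n \<Longrightarrow> r \<in> A' \<and> h s < h r"
      using greedy_column_exists[of ?A ?g "C (Suc n)"] by metis
    let ?F = "\<lambda>r. if r \<in> A' then F r @ [h r] else F r"
    have lenA': "length (F r) = Suc n" if "r \<in> A'" for r using A'(1) that by auto
    have lt: "c < length (?F r) \<longleftrightarrow> c < length (F r) \<or> (c = Suc n \<and> r \<in> A')" for c r
      using lenA' by auto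
    have old: "?F r ! c = F r ! c" if "c < length (F r)" for c r
      using that by (auto simp: nth_append)
    have new: "?F r ! Suc n = h r" if "r \<in> A'" for r
      using that lenA'[OF that] by (auto simp: nth_append)
    have noold: "\<not> Suc n < length (F r)" for r using F(7) by (simp add: leD)
    have "\<forall>r. ?F r \<noteq> [] \<longleftrightarrow> r \<in> A"
    proof
      fix r
      have "r \<in> A" if "r \<in> A'"
        using lenA'[OF that] F(1) by (metis length_0_conv nat.distinct(1))
      then show "?F r \<noteq> [] \<longleftrightarrow> r \<in> A" using F(1) by (cases "r \<in> A'") simp_all
    qed
    moreover have "\<forall>r\<in>A. ?F r ! 0 = g r" using F(1,2) old by simp
    moreover have "decr_rows ?F"
      unfolding decr_rows_def
    proof (intro allI impI)
      fix r c assume "Suc c < length (?F r)"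
      then consider "Suc c < length (F r)" | "c = n" "r \<in> A'" using lt by auto
      then show "?F r ! Suc c \<le> ?F r ! c"
      proof cases
        case 1
        then show ?thesis using F(3) old[of c r] old[of "Suc c" r] unfolding decr_rows_def by auto
      next
        case 2
        then show ?thesis using A'(4) old[of c r] new[of r] lenA'[of r] by auto
      qed
    qed
    moreover have "distinct_cols ?F"
      unfolding distinct_cols_def
    proof (intro allI impI)
      fix r s c assume rs: "r \<noteq> s" and "c < length (?F r)" "c < length (?F s)"
      then consider "c < length (F r)" "c < length (F s)" | "c = Suc n" "r \<in> A'" "s \<in> A'"
        using lt noold by metis
      then show "?F r ! c \<noteq> ?F s ! c"
      proof cases
        case 1
        then show ?thesis using F(4) rs old[of c r] old[of c s] unfolding distinct_cols_def by auto
      next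
        case 2
        then show ?thesis using A'(2) rs new[of r] new[of s] by (auto simp: inj_on_eq_iff)
      qed
    qed
    moreover have "greedy ?F"
      unfolding greedy_def
    proof (intro allI impI)
      fix r s c
      assume rs: "r < s" and s: "Suc c < length (?F s)" and r: "c < length (?F r)"
        and le: "?F s ! Suc c \<le> ?F r ! c"
      have "c \<noteq> Suc n" using s lt[of "Suc c" s] noold[of s] by auto
      then have cr: "c < length (F r)" using r lt[of c r] by simp
      from s consider "Suc c < length (F s)" | "c = n" "s \<in> A'" using lt by auto
      then show "Suc c < length (?F r) \<and> ?F s ! Suc c < ?F r ! Suc c"
      proof cases
        case 1
        then have "F s ! Suc c \<le> F r ! c" using le old[of "Suc c" s] old[OF cr] by simp
        then have "Suc c < length (F r)" "F s ! Suc c < F r ! Suc c"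
          using F(5) rs 1 cr unfolding greedy_def by blast+
        then show ?thesis using old[of "Suc c" s] old[of "Suc c" r] 1 lt by simp
      next
        case 2
        then have "h s \<le> F r ! n" "r \<in> ?A" using le new[of s] old[OF cr] lenA cr by auto
        then have "r \<in> A'" "h s < h r" using low 2 rs by auto
        then show ?thesis using 2 new lenA' by simp
      qed
    qed
    moreover have "\<forall>c\<le>Suc n. colset ?F c = C c"
    proof (intro allI impI)
      fix c assume "c \<le> Suc n"
      show "colset ?F c = C c"
      proof (cases "c = Suc n")
        case True
        have "colset ?F (Suc n) = h ` A'"
        proof
          show "colset ?F (Suc n) \<subseteq> h ` A'"
          proof
            fix y assume "y \<in> colset ?F (Suc n)"
            then obtain r where r: "Suc n < length (?F r)" "?F r ! Suc n = y"
              by (rule colset_memE)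
            then have "r \<in> A'" using lt noold by blast
            then show "y \<in> h ` A'" using r new by blast
          qed
          show "h ` A' \<subseteq> colset ?F (Suc n)"
          proof
            fix y assume "y \<in> h ` A'"
            then obtain r where "r \<in> A'" "y = h r" by blast
            then show "y \<in> colset ?F (Suc n)"
              using colset_memI[of "Suc n" ?F r] new[of r] lt[of "Suc n" r] by simp
          qed
        qed
        then show ?thesis using True A'(3) by simp
      next
        case False
        then have "c < length (?F r) \<longleftrightarrow> c < length (F r)" for r using lt by blast
        then have "colset ?F c = colset F c"
          unfolding colset_def by (rule_tac Collect_cong) (metis old)
        then show ?thesis using F(6) False \<open>c \<le> Suc n\<close> by simp
      qed
    qed
    moreover have "\<forall>r. length (?F r) \<le> Suc (Suc n)" using F(7) by (simp add: le_SucI)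
    ultimately show ?case by (intro exI[of _ ?F]) blast
  qed
  obtain K where K: "\<forall>c\<ge>K. C c = {}" using C unfolding column_family_def by blast
  obtain F where F: "\<forall>r. F r \<noteq> [] \<longleftrightarrow> r \<in> A" "\<forall>r\<in>A. F r ! 0 = g r" "decr_rows F"
    "distinct_cols F" "greedy F" "\<forall>c\<le>K. colset F c = C c" "\<forall>r. length (F r) \<le> Suc K"
    using ex[of K] by blast
  have "colset F c = C c" for c
  proof (cases "c \<le> K")
    case False
    then have "\<not> c < length (F r)" for r using spec[OF F(7), of r] by linarith
    then have "colset F c = {}" by (simp add: colset_def)
    then show ?thesis using K False by simp
  qed (use F(6) in simp)
  then have "colset F = C" by blast
  then show thesis by (rule that[OF F(1-5)])
qed

section \<open>Peeling off the lowest longest row\<close>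

definition key_filling :: "(nat \<Rightarrow> nat list) \<Rightarrow> bool" where
  "key_filling F \<longleftrightarrow> finite {r. F r \<noteq> []} \<and> first_col_index F \<and> decr_rows F \<and>
     distinct_cols F \<and> key_rows F"

lemma key_rows_above:
  assumes "key_rows F" "r < s" "c < length (F r)" "c < length (F s)" "F s ! c < F r ! c"
  shows "Suc c < length (F r) \<and> F s ! c < F r ! Suc c"
  using assms unfolding key_rows_def by blast

lemma key_rows_longer:
  assumes "key_rows F" "r < s" "length (F r) < length (F s)" "c < length (F r)"
  shows "F r ! c < F s ! Suc c"
  using assms unfolding key_rows_def by blast

lemma colset_fun_upd_Nil:
  assumes "distinct_cols F"
  shows "colset (F(r := [])) c = (if c < length (F r) then colset F c - {F r ! c} else colset F c)"
proof -
  have *: "y \<in> colset (F(r := [])) c \<longleftrightarrow> (\<exists>s. s \<noteq> r \<and> c < length (F s) \<and> F s ! c = y)" for y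
    unfolding colset_def by auto
  have "F s ! c \<noteq> F r ! c" if "s \<noteq> r" "c < length (F s)" "c < length (F r)" for s
    using assms that unfolding distinct_cols_def by blast
  then show ?thesis
    unfolding set_eq_iff * by (auto simp: colset_def) metis+
qed

text \<open>All conditions on two rows need a cell in each of them, so emptying a row only removes
  instances.\<close>

lemma key_filling_fun_upd_Nil:
  assumes "key_filling F"
  shows "key_filling (F(r := []))"
proof -
  have "finite {s. (F(r := [])) s \<noteq> []}"
    by (rule finite_subset[of _ "{s. F s \<noteq> []}"]) (use assms in \<open>auto simp: key_filling_def\<close>)
  then show ?thesis
    using assms
    unfolding key_filling_def first_col_index_def decr_rows_def distinct_cols_def key_rows_def
    by simp
qed

text \<open>\<open>sel\<close> runs from the last column to the first, each choice being the
  threshold for the column to its left. The hypothesis spells out this recursion position by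
  position, with \<open>b\<close> as the threshold in the last column.\<close>

lemma sel_eqI:
  assumes "length ys = n"
    and "\<And>c. c < n \<Longrightarrow> ys ! c = Min {z \<in> Cs ! c. (if Suc c < n then ys ! Suc c else b) \<le> z}"
  shows "sel Cs n b = ys"
  using assms
proof (induction n arbitrary: b ys)
  case 0
  then show ?case by simp
next
  case (Suc n)
  have last: "ys ! n = Min {z \<in> Cs ! n. b \<le> z}"
    using Suc.prems(2)[of n] by simp
  have "sel Cs n (ys ! n) = take n ys"
  proof (rule Suc.IH)
    show "length (take n ys) = n" using Suc.prems(1) by simp
    fix c assume c: "c < n"
    show "take n ys ! c =
      Min {z \<in> Cs ! c. (if Suc c < n then take n ys ! Suc c else ys ! n) \<le> z}"
    proof (cases "Suc c < n")
      case True
      then show ?thesis using Suc.prems(2)[of c] by simp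
    next
      case False
      then have "Suc c = n" using c by simp
      then show ?thesis using Suc.prems(2)[of c] by auto
    qed
  qed
  moreover have "ys = take n ys @ [ys ! n]"
    using Suc.prems(1) by (metis lessI order_refl take_Suc_conv_app_nth take_all)
  ultimately show ?case
    using last by (simp add: Let_def)
qed

text \<open>Suppose an eligible entry \<open>z\<close> of column \<open>c\<close> in row
  \<open>s\<close> were smaller than \<open>F r ! c\<close>. If row \<open>s\<close> is above,
  condition (3) gives row \<open>r\<close> a right neighbour > \<open>z\<close>; if it is below, it
  is strictly shorter and condition (4) gives the same. This contradicts eligibility or, in the last
  column, the length of row \<open>r\<close>.\<close>

lemma lowest_longest_row:
  assumes F: "key_filling F" and r: "length (F r) = Suc k"
    and longest: "\<And>s. length (F s) \<le> Suc k" and lowest: "\<And>s. s < r \<Longrightarrow> length (F s) < Suc k"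
    and c: "c \<le> k"
  shows "F r ! c = Min {z \<in> colset F c. (if Suc c < Suc k then F r ! Suc c else 0) \<le> z}"
    (is "_ = Min ?Z")
proof (rule Min_eqI[symmetric])
  have key: "key_rows F" using F by (simp add: key_filling_def)
  show "finite ?Z" using F finite_colset unfolding key_filling_def by simp
  show "F r ! c \<in> ?Z"
    using F c r colset_memI[of c F r] unfolding key_filling_def decr_rows_def by auto
  fix z assume z: "z \<in> ?Z"
  then obtain s where s: "c < length (F s)" "F s ! c = z" by (auto elim: colset_memE)
  show "F r ! c \<le> z"
  proof (rule ccontr)
    assume "\<not> F r ! c \<le> z"
    then have less: "F s ! c < F r ! c" using s by simp
    consider "r < s" | "s < r" using less by (metis less_irrefl linorder_neqE_nat)
    then have "Suc c < length (F r) \<and> F s ! c < F r ! Suc c"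
    proof cases
      case 1
      then show ?thesis using key_rows_above[OF key 1 _ s(1) less] r c by simp
    next
      case 2
      then have "length (F s) < length (F r)" using lowest r by simp
      then show ?thesis using key_rows_longer[OF key 2 _ s(1)] s(1) by simp
    qed
    then show False using z s r by auto
  qed
qed

text \<open>By \<open>lowest_longest_row\<close> each round recovers the lowest longest row and
  leaves the column sets of the filling with that row emptied. The accumulator \<open>R\<close> is
  arbitrary because it carries the rows peeled off earlier; a round costs one unit of fuel and one
  nonempty row.\<close>

lemma psi_aux_colset:
  assumes "key_filling F" and "\<And>r. length (F r) \<le> w" and "card {r. F r \<noteq> []} \<le> n"
  shows "psi_aux n (map (colset F) [0..<w]) R = (\<lambda>r. if F r = [] then R r else F r)"
  using assms
proof (induction n arbitrary: F R)
  case 0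
  then show ?case by (auto simp: key_filling_def)
next
  case (Suc n)
  note F = Suc.prems(1)
  let ?Cs = "map (colset F) [0..<w]"
  have fin: "finite {r. F r \<noteq> []}" and idx: "first_col_index F" and dist: "distinct_cols F"
    using F by (auto simp: key_filling_def)
  show ?case
  proof (cases "\<forall>r. F r = []")
    case True
    then show ?thesis by (simp add: colset_def)
  next
    case False
    define k where "k = Max {k \<in> {..<length ?Cs}. ?Cs ! k \<noteq> {}}"
    have nonempty: "colset F c \<noteq> {} \<longleftrightarrow> (\<exists>r. c < length (F r))" for c
      by (auto simp: colset_def)
    have len_w: "c < w" if "c < length (F r)" for c r using that Suc.prems(2)[of r] by simp
    have K_eq: "{k \<in> {..<length ?Cs}. ?Cs ! k \<noteq> {}} = {k. \<exists>r. k < length (F r)}" (is "?K = _")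
    proof (rule Collect_cong)
      fix c
      show "c \<in> {..<length ?Cs} \<and> ?Cs ! c \<noteq> {} \<longleftrightarrow> (\<exists>r. c < length (F r))"
        using nonempty[of c] len_w[of c] by (cases "c < w") auto
    qed
    have "finite ?K" by simp
    moreover have "?K \<noteq> {}" unfolding K_eq using False by auto
    ultimately have k: "k \<in> ?K" and k_max: "\<And>c. c \<in> ?K \<Longrightarrow> c \<le> k"
      unfolding k_def using Max_in Max_ge by blast+
    have longest: "length (F s) \<le> Suc k" for s
    proof (cases "F s")
      case (Cons a as)
      then have "length (F s) - 1 \<in> ?K" unfolding K_eq by (auto intro!: exI[of _ s])
      then show ?thesis using k_max by fastforce
    qed simp
    define r where "r = (LEAST r. length (F r) = Suc k)"
    have "\<exists>r. length (F r) = Suc k"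
    proof -
      obtain r where "k < length (F r)" using k unfolding K_eq by blast
      then have "length (F r) = Suc k" using longest[of r] by simp
      then show ?thesis ..
    qed
    then have r: "length (F r) = Suc k"
      unfolding r_def by (rule LeastI_ex)
    have lowest: "length (F s) < Suc k" if "s < r" for s
      using not_less_Least[of s "\<lambda>r. length (F r) = Suc k"] that longest[of s]
      unfolding r_def by simp
    have kw: "k < w" using len_w[of k r] r by simp
    have sel: "sel ?Cs (Suc k) 0 = F r"
    proof (rule sel_eqI[OF r])
      fix c assume "c < Suc k"
      then show "F r ! c = Min {z \<in> ?Cs ! c. (if Suc c < Suc k then F r ! Suc c else 0) \<le> z}"
        using lowest_longest_row[OF F r longest lowest, of c] kw by simp
    qed
    have "F r \<noteq> []" using r by auto
    then have hd: "hd (F r) = r" using idx by (simp add: first_col_index_def hd_conv_nth)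
    let ?F = "F(r := [])"
    \<comment> \<open>Since columns are distinct, deleting the chosen values from the column sets is
      the same as emptying row \<open>r\<close>.\<close>
    have Cs': "map (\<lambda>c. if c \<le> k then ?Cs ! c - {F r ! c} else ?Cs ! c) [0..<length ?Cs] =
        map (colset ?F) [0..<w]"
      using colset_fun_upd_Nil[OF dist, of r] r by (auto simp: less_Suc_eq_le)
    have nonempty': "\<not> (\<forall>C \<in> set ?Cs. C = {})"
      using k by (auto simp: image_iff)
    have step: "psi_aux (Suc n) ?Cs R = psi_aux n (map (colset ?F) [0..<w]) (R(r := F r))"
      unfolding psi_aux.simps(2) k_def[symmetric] Let_def sel hd Cs' if_not_P[OF nonempty'] ..
    have "{s. ?F s \<noteq> []} = {s. F s \<noteq> []} - {r}" by auto
    then have "card {s. ?F s \<noteq> []} \<le> n"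
      using Suc.prems(3) fin \<open>F r \<noteq> []\<close> by simp
    then have "psi_aux n (map (colset ?F) [0..<w]) (R(r := F r)) =
        (\<lambda>s. if ?F s = [] then (R(r := F r)) s else ?F s)"
      using Suc.prems(2) by (intro Suc.IH key_filling_fun_upd_Nil[OF F]) auto
    then show ?thesis
      unfolding step using \<open>F r \<noteq> []\<close> by auto
  qed
qed

section \<open>Minimal chains and the existence of key fillings\<close>

text \<open>Applied to adjacent links \<open>a\<close> and \<open>b\<close> of a chain that is
  deleted from the columns. The critical thresholds \<open>x\<close> are those with
  \<open>b < x\<close> and \<open>x <= a\<close>, where the count for \<open>A\<close> drops and
  that for \<open>B\<close> does not.\<close>

lemma dominates_diff:
  assumes dom: "dominates A B" and fin: "finite A" "finite B" and b: "b \<in> B"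
    and a: "a \<in> A" "b \<le> a" and least: "\<And>z. z \<in> A \<Longrightarrow> b \<le> z \<Longrightarrow> a \<le> z"
  shows "dominates (A - {a}) (B - {b})"
  unfolding dominates_def
proof
  fix x
  let ?A = "\<lambda>x. {y \<in> A. x \<le> y}" and ?B = "\<lambda>x. {y \<in> B. x \<le> y}"
  have le: "card (?B z) \<le> card (?A z)" for z using dom by (simp add: dominates_def)
  have eqA: "{y \<in> A - {a}. x \<le> y} = ?A x - {a}" and eqB: "{y \<in> B - {b}. x \<le> y} = ?B x - {b}"
    by auto
  show "card {y \<in> B - {b}. x \<le> y} \<le> card {y \<in> A - {a}. x \<le> y}"
  proof (cases "x \<le> a")
    case False
    then have "?A x - {a} = ?A x" by auto
    moreover have "card (?B x - {b}) \<le> card (?B x)" using fin by (intro card_mono) auto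
    ultimately show ?thesis unfolding eqA eqB using le[of x] by simp
  next
    case True
    \<comment> \<open>Since \<open>a\<close> is the least element of \<open>A\<close> above \<open>b\<close>, both counts may be taken from \<open>min x b\<close>.\<close>
    let ?m = "min x b"
    have "?B x - {b} \<subseteq> ?B ?m - {b}" by auto
    then have "card (?B x - {b}) \<le> card (?B ?m - {b})" using fin by (intro card_mono) auto
    also have "\<dots> = card (?B ?m) - 1" using b fin by simp
    also have "\<dots> \<le> card (?A ?m) - 1" using le by (simp add: diff_le_mono)
    also have "?A ?m = ?A x"
      using True least by (auto simp: min_def split: if_splits) (metis le_trans)
    also have "card (?A x) - 1 = card (?A x - {a})" using a True fin by simp
    finally show ?thesis unfolding eqA eqB .
  qed
qed

text \<open>A selection as in \<open>psi\<close>, starting from \<open>y\<close> in column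
  \<open>k\<close>. Domination at threshold \<open>y\<close> guarantees an admissible entry in the
  column to the left, and the least one is taken.\<close>

lemma minimal_chain_exists:
  assumes "column_family C" and "y \<in> C k"
  shows "\<exists>ys. length ys = Suc k \<and> ys ! k = y \<and> (\<forall>c\<le>k. ys ! c \<in> C c) \<and>
    (\<forall>c<k. ys ! Suc c \<le> ys ! c \<and> (\<forall>z\<in>C c. ys ! Suc c \<le> z \<longrightarrow> ys ! c \<le> z))"
  using assms(2)
proof (induction k arbitrary: y)
  case 0
  then show ?case by (intro exI[of _ "[y]"]) simp
next
  case (Suc k)
  have fin: "finite (C k)" "finite (C (Suc k))" and dom: "dominates (C k) (C (Suc k))"
    using assms(1) by (auto simp: column_family_def)
  let ?Z = "{z \<in> C k. y \<le> z}"
  have "card {z \<in> C (Suc k). y \<le> z} \<noteq> 0" using Suc.prems fin by auto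
  then have "?Z \<noteq> {}" using dom unfolding dominates_def by (metis card.empty le_zero_eq)
  moreover have finZ: "finite ?Z" using fin by simp
  ultimately have Min: "Min ?Z \<in> ?Z" by (rule Min_in[rotated])
  then obtain ys where ys: "length ys = Suc k" "ys ! k = Min ?Z" "\<forall>c\<le>k. ys ! c \<in> C c"
    "\<forall>c<k. ys ! Suc c \<le> ys ! c \<and> (\<forall>z\<in>C c. ys ! Suc c \<le> z \<longrightarrow> ys ! c \<le> z)"
    using Suc.IH[of "Min ?Z"] by auto
  have old: "(ys @ [y]) ! c = ys ! c" if "c \<le> k" for c using that ys(1) by (simp add: nth_append)
  have new: "(ys @ [y]) ! Suc k = y" using ys(1) by (simp add: nth_append)
  have mem: "(ys @ [y]) ! c \<in> C c" if "c \<le> Suc k" for c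
    using that ys(3) old new Suc.prems by (cases "c = Suc k") auto
  have chain: "(ys @ [y]) ! Suc c \<le> (ys @ [y]) ! c \<and>
      (\<forall>z\<in>C c. (ys @ [y]) ! Suc c \<le> z \<longrightarrow> (ys @ [y]) ! c \<le> z)" if "c < Suc k" for c
  proof (cases "c = k")
    case True
    then show ?thesis using old[of k] new ys(2) Min finZ by simp
  next
    case False
    then show ?thesis using that old[of c] old[of "Suc c"] ys(4) by simp
  qed
  show ?case
    by (intro exI[of _ "ys @ [y]"]) (use ys(1) new mem chain in simp)
qed

text \<open>Converse of peeling: the inserted row becomes the lowest among the longest. Minimality
  enters in contrapositive form: an entry of column \<open>c\<close> smaller than
  \<open>ys ! c\<close> is also smaller than \<open>ys ! Suc c\<close>. This yields (3) against the
  rows above the new one and (4) against the rows below it.\<close>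

lemma key_filling_add_row:
  assumes F: "key_filling F" and empty: "F (ys ! 0) = []" and ys: "length ys = Suc k"
    and decr: "\<And>c. c < k \<Longrightarrow> ys ! Suc c \<le> ys ! c"
    and longest: "\<And>r. length (F r) \<le> Suc k"
    and last: "\<And>z. z \<in> colset F k \<Longrightarrow> ys ! k < z"
    and least: "\<And>c z. c < k \<Longrightarrow> z \<in> colset F c \<Longrightarrow> ys ! Suc c \<le> z \<Longrightarrow> ys ! c < z"
    and fresh: "\<And>c. c \<le> k \<Longrightarrow> ys ! c \<notin> colset F c"
  shows "key_filling (F(ys ! 0 := ys))"
proof -
  let ?s = "ys ! 0" and ?F = "F(ys ! 0 := ys)"
  have fin: "finite {r. F r \<noteq> []}" and idx: "first_col_index F" and dec: "decr_rows F"
    and dist: "distinct_cols F" and key: "key_rows F"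
    using F by (auto simp: key_filling_def)
  \<comment> \<open>In the first column the entries are row indices. Further right, an entry smaller
    than \<open>ys ! c\<close> is below \<open>ys ! Suc c\<close> by minimality, and rows weakly
    decrease.\<close>
  have below: "F r ! c < ys ! c" if r: "r < ?s" and "c < length (F r)" for r c
    using that(2)
  proof (induction c)
    case 0
    then show ?case using r idx by (auto simp: first_col_index_def)
  next
    case (Suc c)
    then have "F r ! c < ys ! c" by simp
    moreover have "c < k" using Suc.prems longest[of r] by simp
    moreover have "F r ! c \<in> colset F c" using Suc.prems by (simp add: colset_memI)
    ultimately have "F r ! c < ys ! Suc c" using least by (meson not_le not_less_iff_gr_or_eq)
    moreover have "F r ! Suc c \<le> F r ! c" using dec Suc.prems by (simp add: decr_rows_def)
    ultimately show ?case by simp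
  qed
  \<comment> \<open>A lower row reaching column \<open>k\<close> would have there an entry smaller
    than \<open>ys ! k\<close> by \<open>below\<close> and larger by \<open>last\<close>.\<close>
  have shorter: "length (F r) \<le> k" if "r < ?s" for r
  proof (rule ccontr)
    assume "\<not> length (F r) \<le> k"
    then have "k < length (F r)" by simp
    then show False using below[OF that] last[OF colset_memI[of k F r]] by fastforce
  qed
  have "finite {r. ?F r \<noteq> []}"
    by (rule finite_subset[of _ "insert ?s {r. F r \<noteq> []}"]) (use fin in auto)
  moreover have "first_col_index ?F" using idx by (simp add: first_col_index_def)
  moreover have "decr_rows ?F" using dec decr ys by (simp add: decr_rows_def)
  moreover have "distinct_cols ?F"
    unfolding distinct_cols_def
  proof (intro allI impI)
    fix r t c assume "r \<noteq> t" "c < length (?F r)" "c < length (?F t)"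
    then show "?F r ! c \<noteq> ?F t ! c"
      using dist fresh[of c] colset_memI[of c F r] colset_memI[of c F t] ys
      unfolding distinct_cols_def by (cases "r = ?s"; cases "t = ?s") auto
  qed
  moreover have "Suc c < length (?F r) \<and> ?F t ! c < ?F r ! Suc c"
    if asm: "r < t" "c < length (?F r)" "c < length (?F t)" "?F t ! c < ?F r ! c" for r t c
  proof -
    consider "r = ?s" "t \<noteq> ?s" | "t = ?s" "r \<noteq> ?s" | "t \<noteq> ?s" "r \<noteq> ?s"
      using asm(1) by (metis less_irrefl)
    then show ?thesis
    proof cases
      case 1
      then have t: "F t ! c \<in> colset F c" "F t ! c < ys ! c" "c \<le> k"
        using asm ys by (auto intro: colset_memI)
      then have "c \<noteq> k" using last by fastforce
      then have "c < k" using t by simp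
      then have "F t ! c < ys ! Suc c" using least[OF _ t(1)] t(2) by (meson leI not_less_iff_gr_or_eq)
      then show ?thesis using 1 \<open>c < k\<close> ys by simp
    next
      case 2
      then show ?thesis using asm below[of r c] by auto
    next
      case 3
      then show ?thesis using key_rows_above[OF key asm(1), of c] asm by simp
    qed
  qed
  moreover have "?F r ! c < ?F t ! Suc c"
    if asm: "r < t" "length (?F r) < length (?F t)" "c < length (?F r)" for r t c
  proof -
    consider "r = ?s" "t \<noteq> ?s" | "t = ?s" "r \<noteq> ?s" | "t \<noteq> ?s" "r \<noteq> ?s"
      using asm(1) by (metis less_irrefl)
    then show ?thesis
    proof cases
      case 1
      then show ?thesis using asm longest[of t] ys by simp
    next
      case 2
      then have "c < length (F r)" "r < ?s" using asm by auto
      moreover from this have "c < k" "F r ! c < ys ! c" using shorter[of r] below[of r c] by auto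
      ultimately have "F r ! c < ys ! Suc c"
        using least[of c "F r ! c"] colset_memI[of c F r] by (meson leI not_less_iff_gr_or_eq)
      then show ?thesis using 2 by simp
    next
      case 3
      then show ?thesis using key_rows_longer[OF key asm(1), of c] asm by simp
    qed
  qed
  ultimately show ?thesis
    unfolding key_filling_def key_rows_def by blast
qed

text \<open>Follows the recursion of \<open>psi\<close>: remove the minimal chain that starts at the
  least entry of the last nonempty column, fill the remaining column sets by induction on the size
  of the first one, and put the chain back as row \<open>ys ! 0\<close>.\<close>

lemma key_filling_exists:
  assumes "column_family C"
  shows "\<exists>F. key_filling F \<and> colset F = C"
  using assms
proof (induction "card (C 0)" arbitrary: C rule: less_induct)
  case less
  note C = less.prems
  have fin: "finite (C c)" and nz: "0 \<notin> C c" and dom: "dominates (C c) (C (Suc c))" for c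
    using C by (auto simp: column_family_def)
  show ?case
  proof (cases "C 0 = {}")
    case True
    then have "C c = {}" for c using column_family_empty_mono[OF C True] by simp
    then have "colset (\<lambda>_. []) = C" by (auto simp: colset_def)
    moreover have "key_filling (\<lambda>_. [])"
      by (auto simp: key_filling_def first_col_index_def decr_rows_def distinct_cols_def key_rows_def)
    ultimately show ?thesis by blast
  next
    case False
    obtain K where K: "\<forall>c\<ge>K. C c = {}" using C by (auto simp: column_family_def)
    let ?S = "{c. C c \<noteq> {}}"
    define k where "k = Max ?S"
    have "finite ?S"
    proof (rule finite_subset)
      show "?S \<subseteq> {..<K}" using K by (metis (mono_tags) lessThan_iff mem_Collect_eq not_le subsetI)
    qed simp
    then have k: "C k \<noteq> {}" and k_max: "\<And>c. k < c \<Longrightarrow> C c = {}"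
      unfolding k_def using False Max_in[of ?S] Max_ge[of ?S] leD by blast+
    obtain ys where ys: "length ys = Suc k" "ys ! k = Min (C k)"
      and mem: "\<And>c. c \<le> k \<Longrightarrow> ys ! c \<in> C c"
      and chain: "\<And>c. c < k \<Longrightarrow> ys ! Suc c \<le> ys ! c"
      and least: "\<And>c z. c < k \<Longrightarrow> z \<in> C c \<Longrightarrow> ys ! Suc c \<le> z \<Longrightarrow> ys ! c \<le> z"
      using minimal_chain_exists[OF C Min_in[OF fin k]] by blast
    define C' where "C' = (\<lambda>c. if c \<le> k then C c - {ys ! c} else C c)"
    \<comment> \<open>Left of column \<open>k\<close> two adjacent links are removed together; from
      column \<open>k\<close> on the next column is empty.\<close>
    have "dominates (C' c) (C' (Suc c))" for c
    proof (cases "c < k")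
      case True
      then show ?thesis
        unfolding C'_def using dominates_diff[OF dom fin fin, of "ys ! Suc c" c "ys ! c"]
          mem[of c] mem[of "Suc c"] chain[of c] least[of c] by simp
    next
      case False
      then show ?thesis using k_max by (simp add: C'_def dominates_def)
    qed
    then have C': "column_family C'"
      unfolding column_family_def using fin nz K
      by (intro conjI exI[of _ K]) (auto simp: C'_def)
    have "card (C' 0) < card (C 0)"
      unfolding C'_def using card_Diff1_less[OF fin mem[of 0]] by simp
    then obtain F where F: "key_filling F" "colset F = C'"
      using less.hyps C' by blast
    have longest: "length (F r) \<le> Suc k" for r
    proof (rule ccontr)
      assume "\<not> length (F r) \<le> Suc k"
      then have "F r ! Suc k \<in> C' (Suc k)" using colset_memI[of "Suc k" F r] F(2) by simp
      then show False using k_max by (simp add: C'_def)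
    qed
    \<comment> \<open>Column 0 of \<open>F\<close> consists of row indices and \<open>ys ! 0\<close>
      has been removed from it, so this row is free.\<close>
    have empty: "F (ys ! 0) = []"
    proof (rule ccontr)
      assume ne: "F (ys ! 0) \<noteq> []"
      then have "F (ys ! 0) ! 0 = ys ! 0"
        using F(1) by (simp add: key_filling_def first_col_index_def)
      then have "ys ! 0 \<in> C' 0" using colset_memI[of 0 F "ys ! 0"] ne F(2) by simp
      then show False by (simp add: C'_def)
    qed
    let ?F = "F(ys ! 0 := ys)"
    have "key_filling ?F"
    proof (rule key_filling_add_row[OF F(1) empty ys(1) chain longest])
      show "ys ! k < z" if "z \<in> colset F k" for z
        using that ys(2) Min_le[OF fin, of z k] unfolding F(2) C'_def by fastforce
      show "ys ! c < z" if "c < k" "z \<in> colset F c" "ys ! Suc c \<le> z" for c z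
        using that least[of c z] unfolding F(2) C'_def by fastforce
      show "ys ! c \<notin> colset F c" if "c \<le> k" for c
        using that unfolding F(2) C'_def by simp
    qed
    moreover have "colset ?F c = C c" for c
    proof -
      have "y \<in> colset ?F c \<longleftrightarrow> y \<in> colset F c \<or> (c \<le> k \<and> y = ys ! c)" for y
      proof
        assume "y \<in> colset ?F c"
        then show "y \<in> colset F c \<or> (c \<le> k \<and> y = ys ! c)"
          using ys(1) by (auto simp: colset_def split: if_splits)
      next
        assume "y \<in> colset F c \<or> (c \<le> k \<and> y = ys ! c)"
        then show "y \<in> colset ?F c"
        proof
          assume "y \<in> colset F c"
          then obtain r where r: "c < length (F r)" "F r ! c = y" by (rule colset_memE)
          then have "r \<noteq> ys ! 0" using empty by auto
          then show ?thesis using colset_memI[of c ?F r] r by simp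
        next
          assume "c \<le> k \<and> y = ys ! c"
          then show ?thesis using colset_memI[of c ?F "ys ! 0"] ys(1) by simp
        qed
      qed
      then have "colset ?F c = C' c \<union> (if c \<le> k then {ys ! c} else {})"
        unfolding F(2) by (intro set_eqI) simp
      then show ?thesis
        using mem[of c] by (auto simp: C'_def)
    qed
    ultimately show ?thesis by blast
  qed
qed

section \<open>Column-filling reconstructs a greedy filling\<close>

definition greedy_filling :: "(nat \<Rightarrow> nat list) \<Rightarrow> bool" where
  "greedy_filling F \<longleftrightarrow> first_col_index F \<and> decr_rows F \<and> distinct_cols F \<and> greedy F"

lemma greedyD:
  assumes "greedy F" "r < s" "Suc c < length (F s)" "c < length (F r)" "F s ! Suc c \<le> F r ! c"
  shows "Suc c < length (F r) \<and> F s ! Suc c < F r ! Suc c"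
  using assms unfolding greedy_def by blast

lemma place_eq:
  assumes "s \<in> {1..N}" "length (R s) = c" "x \<le> R s ! (c - 1)"
    and "\<And>r. r \<in> {1..N} \<Longrightarrow> length (R r) = c \<Longrightarrow> x \<le> R r ! (c - 1) \<Longrightarrow> s \<le> r"
  shows "place N c x R = R(s := R s @ [x])"
proof -
  let ?cand = "{r \<in> {1..N}. length (R r) = c \<and> x \<le> R r ! (c - 1)}"
  have "s \<in> ?cand" using assms(1-3) by simp
  moreover from this have "Min ?cand = s" using assms(4) by (intro Min_eqI) auto
  ultimately show ?thesis unfolding place_def Let_def by (metis empty_iff)
qed

text \<open>The starting state is \<open>F\<close> cut off after column \<open>Suc m\<close>, with
  the pending entries \<open>xs\<close> still missing. Let \<open>x\<close>, the largest pending
  entry, belong to row \<open>s\<close>. A row below \<open>s\<close> with an entry >=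
  \<open>x\<close> in column \<open>m\<close> has by greediness an entry > \<open>x\<close> in
  column \<open>Suc m\<close>; that entry is no longer pending, so the row is filled and
  \<open>s\<close> is the lowest candidate.\<close>

lemma fold_place_greedy:
  assumes F: "greedy_filling F" and N: "\<And>r. F r \<noteq> [] \<Longrightarrow> r \<in> {1..N}"
    and "sorted_wrt (>) xs" and "set xs \<subseteq> colset F (Suc m)"
    and "\<forall>z \<in> colset F (Suc m) - set xs. \<forall>x \<in> set xs. x < z"
  shows "fold (place N (Suc m)) xs
      (\<lambda>r. if Suc m < length (F r) \<and> F r ! Suc m \<notin> set xs
           then take (Suc (Suc m)) (F r) else take (Suc m) (F r)) =
    (\<lambda>r. take (Suc (Suc m)) (F r))"
  using assms(3-5)
proof (induction xs)
  case Nil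
  show ?case by (auto simp: fun_eq_iff)
next
  case (Cons x xs)
  let ?n = "Suc m"
  let ?P = "\<lambda>X r. if ?n < length (F r) \<and> F r ! ?n \<notin> X then take (Suc ?n) (F r) else take ?n (F r)"
  have dec: "decr_rows F" and dist: "distinct_cols F" and gr: "greedy F"
    using F by (auto simp: greedy_filling_def)
  obtain s where s: "?n < length (F s)" "F s ! ?n = x"
    using Cons.prems(2) by (auto elim: colset_memE)
  have x: "x \<notin> set xs" "\<And>y. y \<in> set (x # xs) \<Longrightarrow> y \<le> x"
    using Cons.prems(1) by (auto simp: less_imp_le)
  have Ps: "?P (set (x # xs)) s = take ?n (F s)" using s by simp
  have "place N ?n x (?P (set (x # xs))) = (?P (set (x # xs)))(s := ?P (set (x # xs)) s @ [x])"
  proof (rule place_eq)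
    show "s \<in> {1..N}" using N[of s] s(1) by fastforce
    show "length (?P (set (x # xs)) s) = ?n" using Ps s by simp
    have "x \<le> F s ! m" using dec s by (auto simp: decr_rows_def)
    then show "x \<le> ?P (set (x # xs)) s ! (?n - 1)" unfolding Ps by simp
    fix r assume r: "length (?P (set (x # xs)) r) = ?n" "x \<le> ?P (set (x # xs)) r ! (?n - 1)"
    show "s \<le> r"
    proof (rule ccontr)
      assume "\<not> s \<le> r"
      then have "r < s" by simp
      have len: "?n \<le> length (F r)" and no: "\<not> (?n < length (F r) \<and> F r ! ?n \<notin> set (x # xs))"
        using r(1) by (auto split: if_splits)
      have "?P (set (x # xs)) r = take ?n (F r)" by (rule if_not_P[OF no])
      then have "x \<le> F r ! m" using r(2) by simp
      then have "?n < length (F r) \<and> x < F r ! ?n"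
        using greedyD[OF gr \<open>r < s\<close>, of m] s len by simp
      then show False using no x(2) by fastforce
    qed
  qed
  also have "\<dots> = (?P (set (x # xs)))(s := take ?n (F s) @ [x])" unfolding Ps ..
  also have "\<dots> = ?P (set xs)"
  proof
    fix r
    show "((?P (set (x # xs)))(s := take ?n (F s) @ [x])) r = ?P (set xs) r"
    proof (cases "r = s")
      case True
      then show ?thesis using s x(1) by (simp add: take_Suc_conv_app_nth)
    next
      case False
      then have "?n < length (F r) \<Longrightarrow> F r ! ?n \<noteq> x"
        using dist[unfolded distinct_cols_def, rule_format, OF False, of ?n] s by simp
      then show ?thesis using False by auto
    qed
  qed
  finally have step: "place N ?n x (?P (set (x # xs))) = ?P (set xs)" .
  have "fold (place N ?n) xs (?P (set xs)) = (\<lambda>r. take (Suc ?n) (F r))"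
  proof (rule Cons.IH)
    show "sorted_wrt (>) xs" "set xs \<subseteq> colset F ?n" using Cons.prems by auto
    show "\<forall>z\<in>colset F ?n - set xs. \<forall>y\<in>set xs. y < z"
    proof (intro ballI)
      fix z y assume z: "z \<in> colset F ?n - set xs" and y: "y \<in> set xs"
      show "y < z"
      proof (cases "z = x")
        case True
        then show ?thesis using Cons.prems(1) y by simp
      next
        case False
        then show ?thesis using Cons.prems(3) y z by auto
      qed
    qed
  qed
  then show ?case using step by simp
qed

lemma length_le_if_colset_empty:
  assumes "colset F c = {}"
  shows "length (F r) \<le> c"
  using assms colset_memI[of c F r] by (cases "c < length (F r)") auto

text \<open>Induction over the columns, each handled by \<open>fold_place_greedy\<close>; distinct
  entries make the reversed sorted column strictly decreasing, as that lemma requires.\<close>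

lemma fold_fill_column_greedy:
  assumes F: "greedy_filling F" and N: "\<And>r. F r \<noteq> [] \<Longrightarrow> r \<in> {1..N}"
    and cols: "\<And>c. set (column V c) = colset F c" and dist: "\<And>c. distinct (column V c)"
  shows "fold (fill_column N V) [1..<Suc m] (\<lambda>i. if i \<in> set (column V 0) then [i] else []) =
    (\<lambda>r. take (Suc m) (F r))"
proof (induction m)
  case 0
  have idx: "first_col_index F" using F by (simp add: greedy_filling_def)
  have "(if r \<in> set (column V 0) then [r] else []) = take (Suc 0) (F r)" for r
  proof (cases "F r")
    case Nil
    have "r \<notin> colset F 0"
    proof
      assume "r \<in> colset F 0"
      then obtain s where "0 < length (F s)" "F s ! 0 = r" by (rule colset_memE)
      then show False using idx Nil unfolding first_col_index_def by (cases "s = r") auto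
    qed
    then show ?thesis using Nil cols by simp
  next
    case (Cons a as)
    then have "a = r" using idx unfolding first_col_index_def by (metis list.discI nth_Cons_0)
    then show ?thesis using Cons colset_memI[of 0 F r] cols by simp
  qed
  then show ?case by simp
next
  case (Suc m)
  let ?xs = "rev (sort (column V (Suc m)))"
  have "sorted_wrt (<) (sort (column V (Suc m)))"
    using dist by (simp add: strict_sorted_iff)
  then have sorted: "sorted_wrt (>) ?xs" by (simp add: sorted_wrt_rev)
  have set: "set ?xs = colset F (Suc m)" using cols by simp
  \<comment> \<open>At first every entry of column \<open>Suc m\<close> is pending, so the state of
    \<open>fold_place_greedy\<close> is the plain truncation.\<close>
  have "(\<lambda>r. take (Suc m) (F r)) = (\<lambda>r. if Suc m < length (F r) \<and> F r ! Suc m \<notin> set ?xs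
      then take (Suc (Suc m)) (F r) else take (Suc m) (F r))"
    unfolding set using colset_memI[of "Suc m" F] by (intro ext) auto
  moreover have "fold (place N (Suc m)) ?xs \<dots> = (\<lambda>r. take (Suc (Suc m)) (F r))"
    using sorted set by (intro fold_place_greedy[OF F N]) auto
  ultimately have "fill_column N V (Suc m) (\<lambda>r. take (Suc m) (F r)) = (\<lambda>r. take (Suc (Suc m)) (F r))"
    unfolding fill_column_def by simp
  then show ?case using Suc.IH by simp
qed

section \<open>Fillings as lists of rows\<close>

definition rows :: "filling \<Rightarrow> nat \<Rightarrow> nat list" where
  "rows T r = (if r < length T then T ! r else [])"

text \<open>Tableaux use \<open>rows\<close> with list indices. Skyline fillings use this shift,
  under which the index of a row is its number and thus comparable with its first entry.\<close>

definition sky_rows :: "filling \<Rightarrow> nat \<Rightarrow> nat list" where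
  "sky_rows T r = (case r of 0 \<Rightarrow> [] | Suc r \<Rightarrow> rows T r)"

lemma less_length_rows: "c < length (rows T r) \<longleftrightarrow> r < length T \<and> c < length (T ! r)"
  by (simp add: rows_def)

lemma column_conv_filter:
  "column T c = map (\<lambda>r. T ! r ! c) (filter (\<lambda>r. c < length (T ! r)) [0..<length T])"
proof -
  have "concat (map (\<lambda>r. if P r then [f r] else []) xs) = map f (filter P xs)" for P xs
    and f :: "nat \<Rightarrow> nat"
    by (induction xs) auto
  then show ?thesis by (simp add: column_def)
qed

lemma set_column: "set (column T c) = colset (rows T) c"
  by (auto simp: column_conv_filter colset_def rows_def)

lemma colset_sky_rows: "colset (sky_rows T) c = colset (rows T) c"
proof
  show "colset (sky_rows T) c \<subseteq> colset (rows T) c"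
    by (auto simp: sky_rows_def intro!: colset_memI elim!: colset_memE split: nat.splits)
  show "colset (rows T) c \<subseteq> colset (sky_rows T) c"
  proof
    fix y assume "y \<in> colset (rows T) c"
    then obtain r where "c < length (rows T r)" "rows T r ! c = y" by (rule colset_memE)
    then show "y \<in> colset (sky_rows T) c"
      using colset_memI[of c "sky_rows T" "Suc r"] by (simp add: sky_rows_def)
  qed
qed

lemma finite_rows: "finite {r. rows T r \<noteq> []}"
  by (rule finite_subset[of _ "{..<length T}"]) (auto simp: rows_def split: if_splits)

lemma finite_sky_rows: "finite {r. sky_rows T r \<noteq> []}"
proof (rule finite_subset)
  show "{r. sky_rows T r \<noteq> []} \<subseteq> Suc ` {r. rows T r \<noteq> []}"
  proof
    fix r assume "r \<in> {r. sky_rows T r \<noteq> []}"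
    then show "r \<in> Suc ` {r. rows T r \<noteq> []}" by (cases r) (auto simp: sky_rows_def)
  qed
qed (rule finite_imageI[OF finite_rows])

lemma le_foldr_max: "x \<in> set xs \<Longrightarrow> x \<le> foldr max xs (0::nat)"
  by (induction xs) auto

lemma length_le_width: "length (rows T r) \<le> width T"
  unfolding width_def rows_def by (auto intro: le_foldr_max)

lemma set_column_subset_concat: "set (column T c) \<subseteq> set (concat T)"
  by (auto simp: column_conv_filter) (meson nth_mem)

lemma column_le_max_entry: "y \<in> set (column T c) \<Longrightarrow> y \<le> max_entry T"
  unfolding max_entry_def using set_column_subset_concat le_foldr_max by blast

text \<open>Only the columns in which a value occurs matter, never the rows. Hence the property
  transfers between fillings with equal column sets.\<close>

lemma quasi_yamanouchi_iff_columns: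
  "quasi_yamanouchi T \<longleftrightarrow>
     (\<forall>i \<in> (\<Union>c. set (column T c)). Min {c. i \<in> set (column T c)} = 0 \<or>
        (\<exists>c \<ge> Min {c. i \<in> set (column T c)}. Suc i \<in> set (column T c)))"
proof -
  have mem: "y \<in> set (column T c) \<longleftrightarrow> (\<exists>r. (r, c) \<in> occ T y)" for y c
    by (auto simp: set_column colset_def less_length_rows occ_def cells_def rows_def)
  have vals: "vals T = (\<Union>c. set (column T c))"
    by (force simp: mem vals_def occ_def)
  have snd: "snd ` occ T i = {c. i \<in> set (column T c)}" for i
    by (force simp: mem)
  have ex: "(\<exists>(r, c) \<in> occ T i. d \<le> c) \<longleftrightarrow> (\<exists>c\<ge>d. i \<in> set (column T c))" for i d
    by (auto simp: mem)
  show ?thesis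
    unfolding quasi_yamanouchi_def Let_def vals snd ex ..
qed

lemma strip_empty_snoc: "strip_empty (T @ [x]) = (if x = [] then strip_empty T else T @ [x])"
  by (simp add: strip_empty_def)

lemma rows_strip_empty: "rows (strip_empty T) = rows T"
proof (induction T rule: rev_induct)
  case Nil
  then show ?case by (simp add: strip_empty_def)
next
  case (snoc x T)
  have "rows (T @ [[]]) = rows T" by (auto simp: rows_def nth_append)
  then show ?case using snoc by (simp add: strip_empty_snoc)
qed

lemma normalized_sky_strip_empty: "normalized_sky (strip_empty T)"
proof (induction T rule: rev_induct)
  case Nil
  then show ?case by (simp add: strip_empty_def normalized_sky_def)
next
  case (snoc x T)
  then show ?case by (simp add: strip_empty_snoc) (simp add: normalized_sky_def)
qed

lemma sky_rows_sky_of: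
  assumes "\<And>r. R r \<noteq> [] \<Longrightarrow> r \<in> {1..N}"
  shows "sky_rows (sky_of R N) = R"
proof
  fix r
  show "sky_rows (sky_of R N) r = R r"
  proof (cases r)
    case 0
    then show ?thesis using assms[of 0] by (cases "R 0") (auto simp: sky_rows_def)
  next
    case (Suc r')
    have "rows (map R [1..<Suc N]) r' = R (Suc r')"
    proof (cases "r' < N")
      case False
      then show ?thesis using assms[of r] Suc by (cases "R r") (auto simp: rows_def)
    qed (simp add: rows_def del: upt_Suc)
    then show ?thesis using Suc by (simp add: sky_rows_def sky_of_def rows_strip_empty)
  qed
qed

lemma normalized_sky_sky_of: "normalized_sky (sky_of R N)"
  by (simp add: sky_of_def normalized_sky_strip_empty)

text \<open>The row function forgets trailing empty rows; the length of the list is recovered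
  because the last row of a normalised list is nonempty.\<close>

lemma sky_rows_inject:
  assumes "sky_rows T = sky_rows U" "normalized_sky T" "normalized_sky U"
  shows "T = U"
proof -
  have *: "rows T = rows U"
  proof
    fix r
    show "rows T r = rows U r" using fun_cong[OF assms(1), of "Suc r"] by (simp add: sky_rows_def)
  qed
  have le: "length U \<le> length T" if "rows T = rows U" "normalized_sky U" for T U
  proof (rule ccontr)
    assume "\<not> length U \<le> length T"
    then have lt: "length T < length U" by simp
    then have "U \<noteq> []" by auto
    then have "last U \<noteq> []" using that(2) by (simp add: normalized_sky_def)
    then have "rows U (length U - 1) \<noteq> []" using \<open>U \<noteq> []\<close> by (simp add: rows_def last_conv_nth)
    moreover have "rows T (length U - 1) = []" using lt by (auto simp: rows_def)
    ultimately show False using that(1) by simp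
  qed
  have len: "length T = length U"
    using le[OF * assms(3)] le[OF *[symmetric] assms(2)] by simp
  show ?thesis
  proof (rule nth_equalityI[OF len])
    fix r assume "r < length T"
    then show "T ! r = U ! r" using fun_cong[OF *, of r] len by (simp add: rows_def)
  qed
qed

section \<open>Conditions on lists of rows in terms of row functions\<close>

lemma decr_rows_rows: "decr_rows (rows T) \<longleftrightarrow> rows_weakly_decr T"
  unfolding decr_rows_def rows_weakly_decr_def by (auto simp: rows_def)

lemma distinct_cols_rows: "distinct_cols (rows T) \<longleftrightarrow> columns_distinct T"
  unfolding distinct_cols_def columns_distinct_def by (auto simp: rows_def)

lemma positive_entries_iff: "positive_entries T \<longleftrightarrow> (\<forall>c. 0 \<notin> colset (rows T) c)"
  unfolding positive_entries_def cells_def colset_def by (auto simp: rows_def) fastforce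

lemma sky_rows_Suc: "sky_rows T (Suc r) = rows T r"
  by (simp add: sky_rows_def)

lemma sky_rows_0: "sky_rows T 0 = []"
  by (simp add: sky_rows_def)

lemma all_nat_iff: "(\<forall>r. P r) \<longleftrightarrow> P 0 \<and> (\<forall>r. P (Suc r))"
proof safe
  fix r assume "P 0" "\<forall>r. P (Suc r)"
  then show "P r" by (cases r) auto
qed auto

lemma decr_rows_sky_rows: "decr_rows (sky_rows T) \<longleftrightarrow> rows_weakly_decr T"
  unfolding decr_rows_rows[symmetric] decr_rows_def
  by (subst all_nat_iff) (simp add: sky_rows_Suc sky_rows_0)

lemma distinct_cols_sky_rows: "distinct_cols (sky_rows T) \<longleftrightarrow> columns_distinct T"
  unfolding distinct_cols_rows[symmetric]
proof
  assume *: "distinct_cols (sky_rows T)"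
  show "distinct_cols (rows T)"
    unfolding distinct_cols_def
  proof (intro allI impI)
    fix r s c assume "r \<noteq> s" "c < length (rows T r)" "c < length (rows T s)"
    then show "rows T r ! c \<noteq> rows T s ! c"
      using *[unfolded distinct_cols_def, rule_format, of "Suc r" "Suc s" c]
      by (simp add: sky_rows_Suc)
  qed
next
  assume *: "distinct_cols (rows T)"
  show "distinct_cols (sky_rows T)"
    unfolding distinct_cols_def
  proof (intro allI impI)
    fix r s c assume "r \<noteq> s" "c < length (sky_rows T r)" "c < length (sky_rows T s)"
    then show "sky_rows T r ! c \<noteq> sky_rows T s ! c"
      using * by (cases r; cases s) (auto simp: sky_rows_Suc sky_rows_0 distinct_cols_def)
  qed
qed

lemma first_col_index_sky_rows: "first_col_index (sky_rows T) \<longleftrightarrow> first_col_rows T"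
proof -
  have "first_col_index (sky_rows T) \<longleftrightarrow> (\<forall>r. rows T r \<noteq> [] \<longrightarrow> rows T r ! 0 = Suc r)"
    unfolding first_col_index_def
    by (subst all_nat_iff) (simp add: sky_rows_Suc sky_rows_0)
  also have "\<dots> \<longleftrightarrow> first_col_rows T"
    unfolding first_col_rows_def by (auto simp: rows_def)
  finally show ?thesis .
qed

text \<open>Separates the pairs involving the empty row 0 of \<open>sky_rows\<close> from those that
  come from the list with indices shifted by one.\<close>

lemma all_less_Suc_iff:
  "(\<forall>r s. r < s \<longrightarrow> P r s) \<longleftrightarrow> (\<forall>s. P 0 (Suc s)) \<and> (\<forall>r s. r < s \<longrightarrow> P (Suc r) (Suc s))"
  (is "?L \<longleftrightarrow> ?R")
proof
  assume ?R
  show ?L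
  proof (intro allI impI)
    fix r s :: nat assume "r < s"
    then show "P r s" using \<open>?R\<close> by (cases r; cases s) auto
  qed
qed auto

lemma key_rows_sky_rows:
  "key_rows (sky_rows T) \<longleftrightarrow>
     (\<forall>r s c. r < s \<longrightarrow> s < length T \<longrightarrow> c < length (T ! r) \<longrightarrow> c < length (T ! s) \<longrightarrow>
            T ! s ! c < T ! r ! c \<longrightarrow>
            (Suc c < length (T ! r) \<and> T ! s ! c < T ! r ! Suc c))
     \<and> (\<forall>r s c. r < s \<longrightarrow> s < length T \<longrightarrow> length (T ! r) < length (T ! s) \<longrightarrow>
            c < length (T ! r) \<longrightarrow> Suc c < length (T ! s) \<longrightarrow>
            T ! r ! c < T ! s ! Suc c)" (is "_ \<longleftrightarrow> ?A \<and> ?B")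
proof -
  let ?A' = "\<forall>r s. r < s \<longrightarrow> (\<forall>c. c < length (sky_rows T r) \<longrightarrow> c < length (sky_rows T s) \<longrightarrow>
    sky_rows T s ! c < sky_rows T r ! c \<longrightarrow>
    Suc c < length (sky_rows T r) \<and> sky_rows T s ! c < sky_rows T r ! Suc c)"
  let ?B' = "\<forall>r s. r < s \<longrightarrow> (\<forall>c. length (sky_rows T r) < length (sky_rows T s) \<longrightarrow>
    c < length (sky_rows T r) \<longrightarrow> sky_rows T r ! c < sky_rows T s ! Suc c)"
  have "?A' \<longleftrightarrow> ?A"
    by (subst all_less_Suc_iff) (auto simp: sky_rows_Suc sky_rows_0 rows_def)
  moreover have "?B' \<longleftrightarrow> ?B"
    by (subst all_less_Suc_iff) (auto simp: sky_rows_Suc sky_rows_0 rows_def)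
  moreover have "key_rows (sky_rows T) \<longleftrightarrow> ?A' \<and> ?B'"
    unfolding key_rows_def by blast
  ultimately show ?thesis by simp
qed

lemma decr_rows_le_first:
  assumes "decr_rows F" "c < length (F r)"
  shows "F r ! c \<le> F r ! 0"
  using assms(2)
proof (induction c)
  case (Suc c)
  then have "F r ! Suc c \<le> F r ! c" using assms(1) by (simp add: decr_rows_def)
  then show ?case using Suc by simp
qed simp

text \<open>The entry bound in (1) and the growth of the first column in (2) follow from the first
  column being the row indices and the rows weakly decreasing.\<close>

lemma mem_qKT1_iff:
  "T \<in> qKT1 \<longleftrightarrow> normalized_sky T \<and> key_filling (sky_rows T) \<and> (\<forall>c. 0 \<notin> colset (sky_rows T) c)"
proof -
  have le: "T ! r ! c \<le> Suc r"
    if "rows_weakly_decr T" "first_col_rows T" "r < length T" "c < length (T ! r)" for r c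
  proof -
    have "rows T r ! c \<le> rows T r ! 0"
      by (rule decr_rows_le_first) (use that in \<open>simp_all add: decr_rows_rows less_length_rows\<close>)
    moreover have "T ! r \<noteq> []" using that by auto
    then have "T ! r ! 0 = Suc r" using that unfolding first_col_rows_def by blast
    ultimately show ?thesis using that by (simp add: rows_def)
  qed
  have less: "T ! r ! 0 < T ! s ! 0"
    if "first_col_rows T" "r < s" "s < length T" "T ! r \<noteq> []" "T ! s \<noteq> []" for r s
    using that by (simp add: first_col_rows_def)
  show ?thesis
    unfolding qKT1_def mem_Collect_eq quasi_key_def key_filling_def key_rows_sky_rows
      decr_rows_sky_rows distinct_cols_sky_rows first_col_index_sky_rows colset_sky_rows
      positive_entries_iff[symmetric]
    by (rule iffI; elim conjE; intro conjI)
      (assumption | rule finite_sky_rows | (intro allI impI, erule (4) le)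
        | (intro allI impI, erule (4) less))+
qed

section \<open>Inversion triples and greediness\<close>

definition inversion_rows :: "(nat \<Rightarrow> nat list) \<Rightarrow> bool" where
  "inversion_rows F \<longleftrightarrow>
     (\<forall>r s. r < s \<longrightarrow> (\<forall>c. length (F s) \<le> length (F r) \<longrightarrow> Suc c < length (F s) \<longrightarrow>
        inversion_triple (F s ! Suc c) (F r ! c) (F r ! Suc c)))
   \<and> (\<forall>r s. r < s \<longrightarrow> (\<forall>c. length (F r) < length (F s) \<longrightarrow> c < length (F r) \<longrightarrow>
        inversion_triple (F r ! c) (F s ! c) (F s ! Suc c)))"

lemma inversion_rows_sky_rows: "inversion_rows (sky_rows T) \<longleftrightarrow> all_inversion_triples T"
proof -
  let ?A' = "\<forall>r s. r < s \<longrightarrow> (\<forall>c. length (sky_rows T s) \<le> length (sky_rows T r) \<longrightarrow>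
    Suc c < length (sky_rows T s) \<longrightarrow>
    inversion_triple (sky_rows T s ! Suc c) (sky_rows T r ! c) (sky_rows T r ! Suc c))"
  let ?B' = "\<forall>r s. r < s \<longrightarrow> (\<forall>c. length (sky_rows T r) < length (sky_rows T s) \<longrightarrow>
    c < length (sky_rows T r) \<longrightarrow>
    inversion_triple (sky_rows T r ! c) (sky_rows T s ! c) (sky_rows T s ! Suc c))"
  have "?A' \<longleftrightarrow> (\<forall>r s c. r < s \<longrightarrow> s < length T \<longrightarrow> length (T ! s) \<le> length (T ! r) \<longrightarrow>
        Suc c < length (T ! s) \<longrightarrow> inversion_triple (T ! s ! Suc c) (T ! r ! c) (T ! r ! Suc c))"
    by (subst all_less_Suc_iff) (auto simp: sky_rows_Suc sky_rows_0 rows_def)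
  moreover have "?B' \<longleftrightarrow> (\<forall>r s c. r < s \<longrightarrow> s < length T \<longrightarrow> length (T ! r) < length (T ! s) \<longrightarrow>
        c < length (T ! r) \<longrightarrow> inversion_triple (T ! r ! c) (T ! s ! c) (T ! s ! Suc c))"
    by (subst all_less_Suc_iff) (auto simp: sky_rows_Suc sky_rows_0 rows_def)
  ultimately show ?thesis
    unfolding inversion_rows_def all_inversion_triples_def by (rule arg_cong2[where f = "(\<and>)"])
qed

text \<open>For a type A triple the assumed inequality excludes the first alternative, and the
  second is the claim. In a type B situation it would force \<open>F s ! 0 < F r ! 0\<close>,
  although first entries are row indices and \<open>r < s\<close>.\<close>

lemma inversion_rows_imp_greedy:
  assumes idx: "first_col_index F" and dec: "decr_rows F" and inv: "inversion_rows F"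
  shows "greedy F"
  unfolding greedy_def
proof (intro allI impI)
  fix r s c
  assume rs: "r < s" and s: "Suc c < length (F s)" and r: "c < length (F r)"
    and le: "F s ! Suc c \<le> F r ! c"
  show "Suc c < length (F r) \<and> F s ! Suc c < F r ! Suc c"
  proof (cases "length (F s) \<le> length (F r)")
    case True
    then have "inversion_triple (F s ! Suc c) (F r ! c) (F r ! Suc c)"
      using inv rs s by (auto simp: inversion_rows_def)
    then show ?thesis using True s le by (auto simp: inversion_triple_def)
  next
    case False
    \<comment> \<open>A type B triple that is not \<open>\<alpha> > \<beta>\<close> propagates leftwards to the first column.\<close>
    have triple: "inversion_triple (F r ! d) (F s ! d) (F s ! Suc d)" if "d < length (F r)" for d
      using inv rs that False unfolding inversion_rows_def by (meson not_le)
    have "d \<le> c \<longrightarrow> F s ! Suc d \<le> F r ! d \<longrightarrow> F s ! 0 < F r ! 0" for d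
    proof (induction d)
      case 0
      have "inversion_triple (F r ! 0) (F s ! 0) (F s ! Suc 0)"
        by (rule triple) (use r in linarith)
      then show ?case by (auto simp: inversion_triple_def)
    next
      case (Suc d)
      show ?case
      proof (intro impI)
        assume d: "Suc d \<le> c" and le': "F s ! Suc (Suc d) \<le> F r ! Suc d"
        then have lt: "Suc d < length (F r)" using r by simp
        then have "inversion_triple (F r ! Suc d) (F s ! Suc d) (F s ! Suc (Suc d))"
          by (rule triple)
        then have "F s ! Suc d < F r ! Suc d" using le' by (auto simp: inversion_triple_def)
        moreover have "F r ! Suc d \<le> F r ! d" using dec lt by (simp add: decr_rows_def)
        ultimately show "F s ! 0 < F r ! 0" using Suc.IH d by simp
      qed
    qed
    then have "F s ! 0 < F r ! 0" using le by blast
    moreover have "F s ! 0 = s" "F r ! 0 = r"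
      using idx s r unfolding first_col_index_def by force+
    ultimately show ?thesis using rs by simp
  qed
qed

text \<open>A type A triple satisfies the first alternative or, by greediness, the second. For type
  B the second alternative always holds, by induction from the right end of row
  \<open>r\<close>.\<close>

lemma greedy_imp_inversion_rows:
  assumes dec: "decr_rows F" and gr: "greedy F"
  shows "inversion_rows F"
  unfolding inversion_rows_def
proof (intro conjI allI impI)
  fix r s c assume rs: "r < s" and "length (F s) \<le> length (F r)" and s: "Suc c < length (F s)"
  then have r: "Suc c < length (F r)" by simp
  then have "F r ! Suc c \<le> F r ! c" using dec by (simp add: decr_rows_def)
  then show "inversion_triple (F s ! Suc c) (F r ! c) (F r ! Suc c)"
    using greedyD[OF gr rs s] r by (cases "F s ! Suc c \<le> F r ! c") (auto simp: inversion_triple_def)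
next
  fix r s c assume rs: "r < s" and len: "length (F r) < length (F s)" and c: "c < length (F r)"
  \<comment> \<open>Otherwise greediness would force row \<open>r\<close> to be at least as long as row \<open>s\<close>.\<close>
  have "F r ! d < F s ! Suc d" if "d < length (F r)" for d
    using that
  proof (induction "length (F r) - d" arbitrary: d rule: less_induct)
    case less
    show ?case
    proof (rule ccontr)
      assume "\<not> F r ! d < F s ! Suc d"
      then have *: "Suc d < length (F r)" "F s ! Suc d < F r ! Suc d"
        using greedyD[OF gr rs, of d] less.prems len by auto
      then have "F r ! Suc d < F s ! Suc (Suc d)" using less.hyps[of "Suc d"] by simp
      moreover have "F s ! Suc (Suc d) \<le> F s ! Suc d" using dec * len by (simp add: decr_rows_def)
      ultimately show False using * by simp
    qed
  qed
  moreover have "F s ! Suc c \<le> F s ! c" using dec c len by (simp add: decr_rows_def)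
  ultimately show "inversion_triple (F r ! c) (F s ! c) (F s ! Suc c)"
    using c by (simp add: inversion_triple_def)
qed

lemma mem_ASSF_iff:
  "T \<in> ASSF \<longleftrightarrow>
     normalized_sky T \<and> greedy_filling (sky_rows T) \<and> (\<forall>c. 0 \<notin> colset (sky_rows T) c)"
proof -
  have "all_inversion_triples T \<longleftrightarrow> greedy (sky_rows T)"
    if "first_col_rows T" "rows_weakly_decr T"
    using that inversion_rows_imp_greedy[of "sky_rows T"] greedy_imp_inversion_rows[of "sky_rows T"]
    by (auto simp: first_col_index_sky_rows decr_rows_sky_rows inversion_rows_sky_rows)
  then show ?thesis
    by (auto simp: ASSF_def greedy_filling_def decr_rows_sky_rows distinct_cols_sky_rows
        first_col_index_sky_rows colset_sky_rows positive_entries_iff)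
qed

section \<open>Reverse semistandard tableaux and column families\<close>

lemma revSSYT_lower_row:
  assumes V: "V \<in> revSSYT" and "r < s" "s < length V" "c < length (V ! s)"
  shows "c < length (V ! r) \<and> V ! s ! c < V ! r ! c"
  using assms(2-)
proof (induction s)
  case (Suc s)
  have *: "c < length (V ! s)" "V ! Suc s ! c < V ! s ! c"
    using V Suc.prems by (fastforce simp: revSSYT_def)+
  show ?case
  proof (cases "r = s")
    case False
    then have "c < length (V ! r) \<and> V ! s ! c < V ! r ! c" using Suc * by simp
    then show ?thesis using * by simp
  qed (use * in simp)
qed simp

lemma filter_downward_closed:
  assumes "\<And>r s. r < s \<Longrightarrow> s < n \<Longrightarrow> P s \<Longrightarrow> P r"
  shows "\<exists>m \<le> n. filter P [0..<n] = [0..<m] \<and> (\<forall>r<n. P r \<longleftrightarrow> r < m)"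
  using assms
proof (induction n)
  case (Suc n)
  then obtain m where m: "m \<le> n" "filter P [0..<n] = [0..<m]" "\<forall>r<n. P r \<longleftrightarrow> r < m"
    by (metis less_SucI)
  show ?case
  proof (cases "P n")
    case True
    then have "\<forall>r<n. P r" using Suc.prems[of _ n] by simp
    then have "filter P [0..<Suc n] = [0..<Suc n]" "\<forall>r<Suc n. P r"
      using True by (auto simp: filter_id_conv less_Suc_eq)
    then show ?thesis by blast
  next
    case False
    then have "filter P [0..<Suc n] = [0..<m]" "\<forall>r<Suc n. P r \<longleftrightarrow> r < m"
      using m by (auto simp: less_Suc_eq)
    then show ?thesis using m(1) le_SucI by blast
  qed
qed simp

text \<open>In a partition shape the rows reaching column \<open>c\<close> form an initial segment,
  so the position in the list \<open>column V c\<close> is the row index.\<close>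

lemma revSSYT_column:
  assumes V: "V \<in> revSSYT"
  shows "\<And>r. r < length V \<and> c < length (V ! r) \<longleftrightarrow> r < length (column V c)"
    and "\<And>r. r < length (column V c) \<Longrightarrow> column V c ! r = V ! r ! c"
    and "sorted_wrt (>) (column V c)"
proof -
  obtain m where m: "m \<le> length V"
    "filter (\<lambda>r. c < length (V ! r)) [0..<length V] = [0..<m]"
    "\<forall>r<length V. c < length (V ! r) \<longleftrightarrow> r < m"
    using filter_downward_closed[of "length V" "\<lambda>r. c < length (V ! r)"] revSSYT_lower_row[OF V]
    by blast
  have col: "column V c = map (\<lambda>r. V ! r ! c) [0..<m]"
    unfolding column_conv_filter m(2) ..
  show "r < length V \<and> c < length (V ! r) \<longleftrightarrow> r < length (column V c)" for r
    using m col by auto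
  show "r < length (column V c) \<Longrightarrow> column V c ! r = V ! r ! c" for r
    by (simp add: col)
  have "V ! s ! c < V ! r ! c" if "r < s" "s < m" for r s
    using revSSYT_lower_row[OF V, of r s c] that m by simp
  then show "sorted_wrt (>) (column V c)"
    unfolding col by (simp add: sorted_wrt_iff_nth_less)
qed

lemma strictly_decreasing_unique:
  fixes xs ys :: "nat list"
  assumes "sorted_wrt (>) xs" "sorted_wrt (>) ys" "set xs = set ys"
  shows "xs = ys"
proof -
  have "rev xs = rev ys"
    using assms by (intro strict_sorted_equal) (simp_all add: sorted_wrt_rev)
  then show ?thesis by simp
qed

text \<open>Columns are strictly decreasing, so each is determined by its set of entries, and the
  column lengths determine the shape.\<close>

lemma revSSYT_columns_inject:
  assumes V: "V \<in> revSSYT" and W: "W \<in> revSSYT"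
    and eq: "\<And>c. set (column V c) = set (column W c)"
  shows "V = W"
proof -
  have col: "column V c = column W c" for c
    using strictly_decreasing_unique[OF revSSYT_column(3)[OF V] revSSYT_column(3)[OF W]] eq .
  have iff: "r < length V \<and> c < length (V ! r) \<longleftrightarrow> r < length W \<and> c < length (W ! r)" for r c
    unfolding revSSYT_column(1)[OF V] revSSYT_column(1)[OF W] col ..
  have "r < length V \<longleftrightarrow> r < length W" for r
    using iff[of r 0] V W by (auto simp: revSSYT_def)
  then have len: "length V = length W" by (metis less_irrefl linorder_neqE_nat)
  show ?thesis
  proof (rule nth_equalityI[OF len])
    fix r assume r: "r < length V"
    have "c < length (V ! r) \<longleftrightarrow> c < length (W ! r)" for c using iff[of r c] r len by simp
    then have len_r: "length (V ! r) = length (W ! r)" by (metis less_irrefl linorder_neqE_nat)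
    show "V ! r = W ! r"
    proof (rule nth_equalityI[OF len_r])
      fix c assume "c < length (V ! r)"
      then have "r < length (column V c)" using revSSYT_column(1)[OF V] r by blast
      then show "V ! r ! c = W ! r ! c"
        using revSSYT_column(2)[OF V] revSSYT_column(2)[OF W] col by metis
    qed
  qed
qed

lemma column_family_revSSYT:
  assumes "V \<in> revSSYT"
  shows "column_family (\<lambda>c. set (column V c))"
proof -
  have "columns_distinct V"
    unfolding columns_distinct_def
    using revSSYT_lower_row[OF assms] by (metis less_irrefl linorder_neqE_nat)
  moreover have "rows_weakly_decr V" "positive_entries V" using assms by (auto simp: revSSYT_def)
  ultimately have "column_family (colset (rows V))"
    by (intro column_family_colset finite_rows)
      (simp_all add: decr_rows_rows distinct_cols_rows positive_entries_iff)
  then show ?thesis by (simp add: set_column)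
qed

text \<open>Greedy filling with the strictly decreasing enumeration of \<open>C 0\<close> as first
  column. Row index 0 is the top row here, so the preference for small indices fills upper rows
  first and produces a partition shape.\<close>

lemma revSSYT_exists:
  assumes C: "column_family C"
  shows "\<exists>V \<in> revSSYT. \<forall>c. set (column V c) = C c"
proof -
  have fin: "finite (C 0)" using C by (simp add: column_family_def)
  define m where "m = card (C 0)"
  define xs where "xs = rev (sorted_list_of_set (C 0))"
  have xs: "length xs = m" "set xs = C 0" using fin by (simp_all add: xs_def m_def)
  have decr: "xs ! s < xs ! r" if "r < s" "s < m" for r s
  proof -
    have "sorted_wrt (>) xs" by (simp add: xs_def sorted_wrt_rev)
    then show ?thesis using that xs(1) by (simp add: sorted_wrt_iff_nth_less)
  qed
  have inj: "inj_on ((!) xs) {..<m}"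
    using xs(1) by (auto simp: xs_def intro!: inj_on_nth)
  have img: "(!) xs ` {..<m} = C 0"
    unfolding xs(2)[symmetric] xs(1)[symmetric] by (auto simp: set_conv_nth)
  obtain F where F: "\<forall>r. F r \<noteq> [] \<longleftrightarrow> r \<in> {..<m}" "\<forall>r\<in>{..<m}. F r ! 0 = xs ! r"
    "decr_rows F" "distinct_cols F" "greedy F" "colset F = C"
    by (rule greedy_filling_exists[OF C finite_lessThan inj img])
  define V where "V = map F [0..<m]"
  have nil: "F r = [] \<longleftrightarrow> m \<le> r" for r using spec[OF F(1), of r] by auto
  have rows: "rows V = F"
  proof
    fix r
    show "rows V r = F r" using nil[of r] by (cases "r < m") (simp_all add: rows_def V_def)
  qed
  have nth: "length V = m" "\<And>r. r < m \<Longrightarrow> V ! r = F r" by (simp_all add: V_def)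
  \<comment> \<open>The first column decreases by the choice of \<open>xs\<close>. Further right,
    \<open>F s ! Suc c <= F s ! c < F r ! c\<close> triggers greediness, which gives both the cell
    in row \<open>r\<close> and the strict inequality.\<close>
  have lower: "c < length (F r) \<and> F s ! c < F r ! c" if rs: "r < s" "s < m" and "c < length (F s)"
    for r s c
    using that(3)
  proof (induction c)
    case 0
    then show ?case using decr[OF rs] nil[of r] F(2) rs by simp
  next
    case (Suc c)
    have "F s ! Suc c \<le> F s ! c" using F(3) Suc.prems by (simp add: decr_rows_def)
    then have "F s ! Suc c \<le> F r ! c" "c < length (F r)" using Suc by simp_all
    then show ?case using greedyD[OF F(5) rs(1) Suc.prems] by simp
  qed
  have "V \<in> revSSYT"
    unfolding revSSYT_def mem_Collect_eq
  proof (intro conjI allI impI)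
    show "V ! r \<noteq> []" if "r < length V" for r using that nil[of r] nth by simp
    show "length (V ! Suc r) \<le> length (V ! r)" if "Suc r < length V" for r
    proof (rule ccontr)
      assume "\<not> length (V ! Suc r) \<le> length (V ! r)"
      then show False using lower[of r "Suc r" "length (F r)"] that nth by simp
    qed
    have "\<And>c. 0 \<notin> colset (rows V) c" using C F(6) rows by (simp add: column_family_def)
    then show "positive_entries V" by (simp add: positive_entries_iff)
    show "rows_weakly_decr V" using F(3) rows by (simp add: decr_rows_rows[symmetric])
    show "V ! Suc r ! c < V ! r ! c" if "Suc r < length V" "c < length (V ! Suc r)" for r c
      using lower[of r "Suc r" c] that nth by simp
  qed
  then show ?thesis using F(6) rows by (auto simp: set_column)
qed

section \<open>Transfer along column sets and the two bijections\<close>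

text \<open>The hypotheses make \<open>f V\<close> the one element of \<open>S\<close> with the
  column sets of \<open>V\<close>. Injectivity holds because a tableau is determined by its column
  sets, surjectivity because every column family comes from a tableau; the quasi-Yamanouchi property
  depends on column sets only.\<close>

lemma bij_betw_quasi_yamanouchi:
  assumes map: "\<And>V T. V \<in> revSSYT \<Longrightarrow> T \<in> S \<Longrightarrow> (\<And>c. set (column T c) = set (column V c)) \<Longrightarrow> f V = T"
    and ex: "\<And>V. V \<in> revSSYT \<Longrightarrow> \<exists>T \<in> S. \<forall>c. set (column T c) = set (column V c)"
    and fam: "\<And>T. T \<in> S \<Longrightarrow> column_family (\<lambda>c. set (column T c))"
  shows "bij_betw f QrevSSYT {T \<in> S. quasi_yamanouchi T}"
proof -
  have f: "f V \<in> S \<and> (\<forall>c. set (column (f V) c) = set (column V c))" if "V \<in> revSSYT" for V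
    using map[OF that] ex[OF that] by metis
  have qy: "quasi_yamanouchi T \<longleftrightarrow> quasi_yamanouchi V"
    if "\<forall>c. set (column T c) = set (column V c)" for T V
    using that by (simp add: quasi_yamanouchi_iff_columns)
  show ?thesis
    unfolding bij_betw_def
  proof (intro conjI)
    show "inj_on f QrevSSYT"
    proof (rule inj_onI)
      fix V W assume "V \<in> QrevSSYT" "W \<in> QrevSSYT" "f V = f W"
      then show "V = W"
        using f[of V] f[of W] by (intro revSSYT_columns_inject) (auto simp: QrevSSYT_def)
    qed
    show "f ` QrevSSYT = {T \<in> S. quasi_yamanouchi T}"
    proof
      show "f ` QrevSSYT \<subseteq> {T \<in> S. quasi_yamanouchi T}"
        using f qy by (fastforce simp: QrevSSYT_def)
      show "{T \<in> S. quasi_yamanouchi T} \<subseteq> f ` QrevSSYT"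
      proof
        fix T assume T: "T \<in> {T \<in> S. quasi_yamanouchi T}"
        then obtain V where V: "V \<in> revSSYT" "\<forall>c. set (column V c) = set (column T c)"
          using revSSYT_exists[OF fam, of T] by auto
        then have "V \<in> QrevSSYT" "f V = T"
          using T qy[of V T] map[of V T] by (auto simp: QrevSSYT_def)
        then show "T \<in> f ` QrevSSYT" by blast
      qed
    qed
  qed
qed

lemma column_family_sky:
  assumes "decr_rows (sky_rows T)" "distinct_cols (sky_rows T)" "\<forall>c. 0 \<notin> colset (sky_rows T) c"
  shows "column_family (\<lambda>c. set (column T c))"
proof -
  have "column_family (colset (sky_rows T))"
    by (rule column_family_colset) (use assms finite_sky_rows in auto)
  moreover have "colset (sky_rows T) = (\<lambda>c. set (column T c))"
    by (simp add: fun_eq_iff colset_sky_rows set_column)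
  ultimately show ?thesis by simp
qed

text \<open>Guarantees that \<open>sky_of\<close> with bound \<open>max_entry V\<close> drops no
  nonempty row: the index of such a row is its first entry, which occurs in
  \<open>V\<close>.\<close>

lemma nonempty_row_bounds:
  assumes "first_col_index F" "colset F 0 = set (column V 0)" "0 \<notin> colset F 0" "F r \<noteq> []"
  shows "r \<in> {1..max_entry V}"
proof -
  have "r \<in> colset F 0"
    using assms(1,4) colset_memI[of 0 F r] by (simp add: first_col_index_def)
  moreover from this have "r \<noteq> 0" using assms(3) by metis
  ultimately show ?thesis using assms(2) column_le_max_entry[of r V 0] by simp
qed

lemma sky_filling_exists:
  assumes "first_col_index F" "V \<in> revSSYT" "colset F = (\<lambda>c. set (column V c))"
  shows "\<exists>T. normalized_sky T \<and> sky_rows T = F \<and> (\<forall>c. set (column T c) = set (column V c))"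
proof -
  have "0 \<notin> colset F 0"
    using column_family_revSSYT[OF assms(2)] assms(3) by (simp add: column_family_def)
  then have "sky_rows (sky_of F (max_entry V)) = F"
    using nonempty_row_bounds[OF assms(1)] assms(3) by (intro sky_rows_sky_of) simp
  then show ?thesis
    using normalized_sky_sky_of[of F "max_entry V"] assms(3) set_column colset_sky_rows by metis
qed

lemma sky_of_sky_rows:
  assumes "normalized_sky T" "first_col_index (sky_rows T)" "0 \<notin> colset (sky_rows T) 0"
    and "\<And>c. set (column T c) = set (column V c)"
  shows "sky_of (sky_rows T) (max_entry V) = T"
proof (rule sky_rows_inject[OF _ normalized_sky_sky_of assms(1)])
  have "colset (sky_rows T) 0 = set (column V 0)"
    using assms(4) by (simp add: colset_sky_rows set_column)
  then show "sky_rows (sky_of (sky_rows T) (max_entry V)) = sky_rows T"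
    using nonempty_row_bounds[OF assms(2) _ assms(3)] by (intro sky_rows_sky_of)
qed

lemma sky_rows_le_width:
  assumes "\<And>c. set (column T c) = set (column V c)"
  shows "length (sky_rows T r) \<le> width V"
proof (rule length_le_if_colset_empty)
  have "colset (rows V) (width V) = {}"
    using length_le_width[of V] by (auto simp: colset_def) (metis leD)
  then show "colset (sky_rows T) (width V) = {}"
    using assms[of "width V"] by (simp add: colset_sky_rows set_column)
qed

lemma psi_eqI:
  assumes "T \<in> qKT1" and cols: "\<And>c. set (column T c) = set (column V c)"
  shows "psi V = T"
proof -
  let ?F = "sky_rows T"
  have T: "normalized_sky T" "key_filling ?F" "\<forall>c. 0 \<notin> colset ?F c"
    using assms(1) by (auto simp: mem_qKT1_iff)
  have idx: "first_col_index ?F" using T(2) by (simp add: key_filling_def)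
  have colset: "colset ?F = (\<lambda>c. set (column V c))"
    using cols by (simp add: fun_eq_iff colset_sky_rows set_column)
  \<comment> \<open>Indices of nonempty rows are first-column entries and so occur in
    \<open>V\<close>. Hence their number is at most the number of cells, which is the fuel of
    \<open>psi_aux\<close>.\<close>
  have "{r. ?F r \<noteq> []} \<subseteq> set (concat V)"
  proof
    fix r assume "r \<in> {r. ?F r \<noteq> []}"
    then have "r \<in> colset ?F 0"
      using idx colset_memI[of 0 ?F r] by (simp add: first_col_index_def)
    then show "r \<in> set (concat V)" using colset set_column_subset_concat[of V 0] by auto
  qed
  then have "card {r. ?F r \<noteq> []} \<le> length (concat V)"
    using card_mono[OF finite_set] card_length le_trans by blast
  then have "psi_aux (length (concat V)) (map (\<lambda>c. set (column V c)) [0..<width V]) (\<lambda>_. []) = ?F"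
    using psi_aux_colset[OF T(2) sky_rows_le_width[OF cols], of "length (concat V)" "\<lambda>_. []"]
    unfolding colset by (auto simp: fun_eq_iff)
  then show ?thesis
    unfolding psi_def using sky_of_sky_rows[OF T(1) idx _ cols] T(3) by simp
qed

lemma Gamma_eqI:
  assumes "T \<in> ASSF" and V: "V \<in> revSSYT" and cols: "\<And>c. set (column T c) = set (column V c)"
  shows "Gamma V = T"
proof -
  let ?F = "sky_rows T"
  have T: "normalized_sky T" "greedy_filling ?F" "\<forall>c. 0 \<notin> colset ?F c"
    using assms(1) by (auto simp: mem_ASSF_iff)
  have idx: "first_col_index ?F" using T(2) by (simp add: greedy_filling_def)
  have colset: "set (column V c) = colset ?F c" for c
    using cols by (simp add: colset_sky_rows set_column)
  have dist: "distinct (column V c)" for c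
  proof -
    have "sorted_wrt (<) (rev (column V c))"
      using revSSYT_column(3)[OF V, of c] by (simp add: sorted_wrt_rev)
    then show ?thesis by (simp add: strict_sorted_iff)
  qed
  \<comment> \<open>For width 0 the truncated subtraction makes both lists empty.\<close>
  have "[1..<width V] = [1..<Suc (width V - 1)]" by (cases "width V") auto
  then have "fold (fill_column (max_entry V) V) [1..<width V]
      (\<lambda>i. if i \<in> set (column V 0) then [i] else []) = (\<lambda>r. take (Suc (width V - 1)) (?F r))"
    using fold_fill_column_greedy[OF T(2) nonempty_row_bounds[OF idx colset[symmetric]] colset dist]
      T(3) by simp
  also have "\<dots> = ?F"
  proof
    fix r
    show "take (Suc (width V - 1)) (?F r) = ?F r" using sky_rows_le_width[OF cols, of r] by simp
  qed
  finally show ?thesis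
    unfolding Gamma_def Let_def using sky_of_sky_rows[OF T(1) idx _ cols] T(3) by simp
qed

lemma bij_betw_psi: "bij_betw psi QrevSSYT QqKT1"
  unfolding QqKT1_def
proof (rule bij_betw_quasi_yamanouchi)
  fix V assume V: "V \<in> revSSYT"
  let ?C = "\<lambda>c. set (column V c)"
  obtain F where F: "key_filling F" "colset F = ?C"
    using key_filling_exists[OF column_family_revSSYT[OF V]] by blast
  then have "first_col_index F" by (simp add: key_filling_def)
  then obtain T where T: "normalized_sky T" "sky_rows T = F" "\<forall>c. set (column T c) = ?C c"
    using sky_filling_exists[OF _ V F(2)] by blast
  moreover have "\<forall>c. 0 \<notin> ?C c" using column_family_revSSYT[OF V] by (simp add: column_family_def)
  ultimately have "T \<in> qKT1" using F by (simp add: mem_qKT1_iff)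
  then show "\<exists>T \<in> qKT1. \<forall>c. set (column T c) = ?C c" using T by blast
next
  fix T assume "T \<in> qKT1"
  then show "column_family (\<lambda>c. set (column T c))"
    by (intro column_family_sky) (auto simp: mem_qKT1_iff key_filling_def)
qed (rule psi_eqI)

lemma bij_betw_Gamma: "bij_betw Gamma QrevSSYT QSSF"
  unfolding QSSF_def
proof (rule bij_betw_quasi_yamanouchi)
  fix V assume V: "V \<in> revSSYT"
  let ?C = "\<lambda>c. set (column V c)"
  have C: "column_family ?C" by (rule column_family_revSSYT[OF V])
  \<comment> \<open>With the identity as first-column map the entry \<open>i\<close> is placed in
    row \<open>i\<close>, as \<open>first_col_index\<close> demands.\<close>
  have img: "(\<lambda>r. r) ` ?C 0 = ?C 0" by simp
  obtain F where F: "\<forall>r. F r \<noteq> [] \<longleftrightarrow> r \<in> ?C 0" "\<forall>r \<in> ?C 0. F r ! 0 = r" "decr_rows F"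
      "distinct_cols F" "greedy F" "colset F = ?C"
    by (rule greedy_filling_exists[OF C finite_set inj_on_id2 img])
  then have gf: "greedy_filling F" by (simp add: greedy_filling_def first_col_index_def)
  then obtain T where T: "normalized_sky T" "sky_rows T = F" "\<forall>c. set (column T c) = ?C c"
    using sky_filling_exists[OF _ V F(6)] by (auto simp: greedy_filling_def)
  moreover have "\<forall>c. 0 \<notin> ?C c" using C by (simp add: column_family_def)
  ultimately have "T \<in> ASSF" using F(6) gf by (simp add: mem_ASSF_iff)
  then show "\<exists>T \<in> ASSF. \<forall>c. set (column T c) = ?C c" using T by blast
next
  fix T assume "T \<in> ASSF"
  then show "column_family (\<lambda>c. set (column T c))"
    by (intro column_family_sky) (auto simp: mem_ASSF_iff greedy_filling_def)
qed (rule Gamma_eqI)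

theorem theorem5p12:
  shows "bij_betw psi QrevSSYT QqKT1 \<and> bij_betw Gamma QrevSSYT QSSF"
  using bij_betw_psi bij_betw_Gamma by blast

end
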